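(* Let $G$ be a finite simple edge-twin-free graph with $m$ edges and no isolated edge. Then $\gamma'_{t,L}(G)\le\frac{2}{3}m$.
   Context: An isolated edge of $G$ is an edge both of whose ends have degree $1$. For an edge $e$, $N(e)$ is the set of edges different from $e$ sharing an end with $e$, and $N[e]=N(e)\cup\{e\}$. Distinct edges $e,f$ are edge-twins if $N(e)=N(f)$ or $N[e]=N[f]$; $G$ is edge-twin-free if it has no pair of edge-twins. A set $D\subseteq E(G)$ is an edge-locating-total-dominating set if every edge of $E(G)$ (including those in $D$) shares an end with some edge of $D$ other than itself, and for every two distinct edges $e,f\in E(G)\setminus D$ we have $N(e)\cap D\neq N(f)\cap D$. The edge-location total domination number $\gamma'_{t,L}(G)$ is the minimum cardinality of such a set. *)

theory Defs
  imports Complex_Main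
begin

definition finite_simple_graph :: "'a set \<Rightarrow> 'a set set \<Rightarrow> bool" where
  "finite_simple_graph V E \<longleftrightarrow> finite V \<and> (\<forall>e\<in>E. e \<subseteq> V \<and> card e = 2)"

definition degree :: "'a set set \<Rightarrow> 'a \<Rightarrow> nat" where
  "degree E v = card {e \<in> E. v \<in> e}"

definition isolated_edge :: "'a set set \<Rightarrow> 'a set \<Rightarrow> bool" where
  "isolated_edge E e \<longleftrightarrow> e \<in> E \<and> (\<forall>v\<in>e. degree E v = 1)"

definition edge_nbhd :: "'a set set \<Rightarrow> 'a set \<Rightarrow> 'a set set" where
  "edge_nbhd E e = {f \<in> E. f \<noteq> e \<and> e \<inter> f \<noteq> {}}"

definition closed_edge_nbhd :: "'a set set \<Rightarrow> 'a set \<Rightarrow> 'a set set" where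
  "closed_edge_nbhd E e = insert e (edge_nbhd E e)"

definition edge_twins :: "'a set set \<Rightarrow> 'a set \<Rightarrow> 'a set \<Rightarrow> bool" where
  "edge_twins E e f \<longleftrightarrow> e \<in> E \<and> f \<in> E \<and> e \<noteq> f \<and>
     (edge_nbhd E e = edge_nbhd E f \<or> closed_edge_nbhd E e = closed_edge_nbhd E f)"

definition edge_twin_free :: "'a set set \<Rightarrow> bool" where
  "edge_twin_free E \<longleftrightarrow> (\<nexists>e f. edge_twins E e f)"

definition edge_locating_total_dominating :: "'a set set \<Rightarrow> 'a set set \<Rightarrow> bool" where
  "edge_locating_total_dominating E D \<longleftrightarrow> D \<subseteq> E \<and>
     (\<forall>e\<in>E. \<exists>f\<in>D. f \<noteq> e \<and> e \<inter> f \<noteq> {}) \<and>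
     (\<forall>e\<in>E - D. \<forall>f\<in>E - D. e \<noteq> f \<longrightarrow> edge_nbhd E e \<inter> D \<noteq> edge_nbhd E f \<inter> D)"

text \<open>The number below is only meaningful when some edge-locating-total-dominating set exists.
  In a finite simple graph without isolated edges this is always so: the whole edge set is one
  (lemma \<open>all_edges_edge_locating_total_dominating\<close>).\<close>

definition edge_location_total_domination_number :: "'a set set \<Rightarrow> nat" where
  "edge_location_total_domination_number E =
     (LEAST k. \<exists>D. edge_locating_total_dominating E D \<and> card D = k)"

lemma all_edges_edge_locating_total_dominating:
  assumes "finite_simple_graph V E" and "\<nexists>e. isolated_edge E e"
  shows "edge_locating_total_dominating E E"
  unfolding edge_locating_total_dominating_def
proof (intro conjI ballI)
  fix e assume e: "e \<in> E"
  have "\<not> isolated_edge E e"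
    using assms(2) by blast
  then obtain v where v: "v \<in> e" "degree E v \<noteq> 1"
    unfolding isolated_edge_def using e by blast
  have "{f \<in> E. v \<in> f} \<noteq> {e}"
  proof
    assume "{f \<in> E. v \<in> f} = {e}"
    then show False
      using v(2) unfolding degree_def by simp
  qed
  then obtain f where "f \<in> E" "v \<in> f" "f \<noteq> e"
    using e v(1) by blast
  then show "\<exists>f\<in>E. f \<noteq> e \<and> e \<inter> f \<noteq> {}"
    using v(1) by blast
qed auto

end

theory Submission
  imports Defs
begin

text \<open>
  Call an acyclic set of edges valid if it is edge-locating-total-dominating, and let \<open>D\<close> be a
  smallest valid set. A spanning forest has one edge fewer than vertices in each component, so it
  suffices to distribute a total charge of at most \<open>2 |E - D|\<close> to the covered vertices such that
  every component \<open>C\<close> of \<open>D\<close> receives at least \<open>|C| - 1\<close>; then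
  \<open>|D| \<le> 2 |E - D|\<close>. Each edge outside \<open>D\<close> gives charge to its covered ends. By
  minimality no edge of \<open>D\<close> can be deleted: for leaf edges this forces charge 2 on the leaf or on
  its neighbour (where twin-freeness allows only one leaf without charge), and for internal edges it
  forces every vertex of one side to be charged, or that side to be a single edge. Hence all vertices
  of \<open>C\<close> but one are paid for.
\<close>

definition nbrs :: "'a set set \<Rightarrow> 'a \<Rightarrow> 'a set" where
  "nbrs F v = {u. {v, u} \<in> F}"

lemma nbrs_iff [simp]: "u \<in> nbrs F v \<longleftrightarrow> {v, u} \<in> F"
  by (simp add: nbrs_def)

lemma nbrs_eqI: "{v, a} \<in> F \<Longrightarrow> (\<And>b. {v, b} \<in> F \<Longrightarrow> b = a) \<Longrightarrow> nbrs F v = {a}"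
  unfolding nbrs_def by blast

definition reach :: "'a set set \<Rightarrow> 'a \<Rightarrow> 'a \<Rightarrow> bool" where
  "reach F = (\<lambda>a b. {a, b} \<in> F)\<^sup>*\<^sup>*"

definition acyc :: "'a set set \<Rightarrow> bool" where
  "acyc F \<longleftrightarrow> (\<forall>a b. {a, b} \<in> F \<longrightarrow> \<not> reach (F - {{a, b}}) a b)"

lemma reach_refl [simp]: "reach F a a"
  by (simp add: reach_def)

lemma reach_step: "reach F a b \<Longrightarrow> {b, c} \<in> F \<Longrightarrow> reach F a c"
  unfolding reach_def by (rule rtranclp.rtrancl_into_rtrancl)

lemma reach_induct [consumes 1, case_names base step]:
  assumes "reach F a b" "P a"
    and "\<And>y z. reach F a y \<Longrightarrow> {y, z} \<in> F \<Longrightarrow> P y \<Longrightarrow> P z"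
  shows "P b"
  using assms unfolding reach_def by (rule rtranclp_induct)

lemma reach_trans: "reach F a b \<Longrightarrow> reach F b c \<Longrightarrow> reach F a c"
  unfolding reach_def by (rule rtranclp_trans)

lemma reach_edge: "{a, b} \<in> F \<Longrightarrow> reach F a b"
  unfolding reach_def by (rule r_into_rtranclp)

lemma reach_sym: "reach F a b \<Longrightarrow> reach F b a"
proof (induction rule: reach_induct)
  case (step y z)
  then have "reach F z y" by (intro reach_edge) (simp add: insert_commute)
  then show ?case using step.IH by (rule reach_trans)
qed simp

lemma reach_mono: "reach F a b \<Longrightarrow> F \<subseteq> F' \<Longrightarrow> reach F' a b"
  by (induction rule: reach_induct) (auto intro: reach_step)

lemma reach_closed:
  assumes "reach F a b" "a \<in> B" "\<And>x y. x \<in> B \<Longrightarrow> {x, y} \<in> F \<Longrightarrow> y \<in> B"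
  shows "b \<in> B"
  using assms(1,2) by (induction rule: reach_induct) (use assms(3) in auto)

lemma acyc_mono:
  assumes "acyc F" "F' \<subseteq> F"
  shows "acyc F'"
  unfolding acyc_def
proof (intro allI impI notI)
  fix a b assume "{a, b} \<in> F'" "reach (F' - {{a, b}}) a b"
  moreover from this(2) have "reach (F - {{a, b}}) a b"
    using assms(2) by (rule reach_mono[OF _ Diff_mono]) auto
  ultimately show False using assms unfolding acyc_def by blast
qed

lemma reach_first_edge:
  assumes "reach F q z" "z \<noteq> q"
  shows "\<exists>a. {q, a} \<in> F \<and> reach (F - {{q, a}}) a z"
proof -
  have "z = q \<or> (\<exists>a. {q, a} \<in> F \<and> reach (F - {{q, a}}) a z)"
    using assms(1)
  proof (induction rule: reach_induct)
    case base
    then show ?case by simp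
  next
    case (step y z)
    show ?case
    proof (cases "y = q \<or> z = q")
      case True
      then show ?thesis using step(2) reach_refl by metis
    next
      case False
      then obtain a where a: "{q, a} \<in> F" "reach (F - {{q, a}}) a y"
        using step.IH by blast
      have "{y, z} \<in> F - {{q, a}}"
        using step(2) False by (auto simp: doubleton_eq_iff)
      then have "reach (F - {{q, a}}) a z"
        using a(2) by (rule reach_step[rotated])
      then show ?thesis using a(1) by blast
    qed
  qed
  then show ?thesis using assms(2) by blast
qed

lemma reach_insert:
  assumes "reach (insert {u, z} F) c d"
  shows "reach F c d \<or> reach F c u \<and> reach F z d \<or> reach F c z \<and> reach F u d"
  using assms
proof (induction rule: reach_induct)
  case base
  then show ?case by simp
next
  case (step y y')
  show ?case
  proof (cases "{y, y'} \<in> F")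
    case True
    then show ?thesis
      using step.IH by (meson reach_step)
  next
    case False
    then have "y = u \<and> y' = z \<or> y = z \<and> y' = u"
      using step(2) by (auto simp: doubleton_eq_iff)
    then show ?thesis using step.IH by auto
  qed
qed

lemma acyc_insert:
  assumes "acyc F" "\<not> reach F u z"
  shows "acyc (insert {u, z} F)"
  unfolding acyc_def
proof (intro allI impI notI)
  fix c d
  assume cd: "{c, d} \<in> insert {u, z} F" and r: "reach (insert {u, z} F - {{c, d}}) c d"
  show False
  proof (cases "{c, d} = {u, z}")
    case True
    then have "reach F c d" using r by (auto elim!: reach_mono)
    then show False using True assms(2) by (auto simp: doubleton_eq_iff dest: reach_sym)
  next
    case False
    then have cdF: "{c, d} \<in> F" using cd by simp
    let ?F = "F - {{c, d}}"
    have "reach (insert {u, z} ?F) c d"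
      using r by (rule reach_mono) auto
    then consider "reach ?F c d" | "reach ?F c u" "reach ?F z d" | "reach ?F c z" "reach ?F u d"
      using reach_insert by metis
    then show False
    proof cases
      case 1
      then show False using assms(1) cdF unfolding acyc_def by blast
    next
      case 2
      then have "reach F c u" "reach F z d" by (auto elim: reach_mono)
      then show False using assms(2) cdF by (meson reach_edge reach_sym reach_trans)
    next
      case 3
      then have "reach F c z" "reach F u d" by (auto elim: reach_mono)
      then show False using assms(2) cdF by (meson reach_edge reach_sym reach_trans)
    qed
  qed
qed

lemma acyc_card:
  assumes "finite F" "finite X" "\<And>e. e \<in> F \<Longrightarrow> e \<subseteq> X \<and> card e = 2" "acyc F"
    and "S \<subseteq> X" "\<And>s t. s \<in> S \<Longrightarrow> t \<in> S \<Longrightarrow> reach F s t \<Longrightarrow> s = t"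
  shows "card F + card S \<le> card X"
  using assms
proof (induction arbitrary: S rule: finite_induct)
  case empty
  then show ?case by (simp add: card_mono)
next
  case (insert e F)
  obtain a b where e: "e = {a, b}" and "a \<noteq> b"
    using insert.prems(2) by (metis card_2_iff insertI1)
  have nab: "\<not> reach F a b"
    using insert.prems(3) insert.hyps(2) unfolding acyc_def e
    by (metis Diff_insert_absorb insertI1)
  have "\<exists>c\<in>{a, b}. \<forall>s\<in>S. \<not> reach F c s"
  proof (rule ccontr)
    assume "\<not> ?thesis"
    then obtain s t where st: "s \<in> S" "t \<in> S" "reach F a s" "reach F b t" by blast
    let ?F = "insert e F"
    have "reach ?F a s" "reach ?F b t" using st by (auto elim: reach_mono)
    moreover have "reach ?F a b" by (rule reach_edge) (simp add: e)
    ultimately have "reach ?F s t" by (meson reach_sym reach_trans)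
    then have "s = t" using insert.prems(5) st by blast
    then show False using st nab by (meson reach_sym reach_trans)
  qed
  then obtain c where c: "c \<in> {a, b}" "\<And>s. s \<in> S \<Longrightarrow> \<not> reach F c s" by blast
  have "c \<notin> S" using c(2)[of c] by auto
  have "card F + card (insert c S) \<le> card X"
  proof (rule insert.IH)
    show "acyc F" using insert.prems(3) by (rule acyc_mono) auto
    show "insert c S \<subseteq> X" using c(1) insert.prems(2)[of e] insert.prems(4) e by auto
    show "s = t" if "s \<in> insert c S" "t \<in> insert c S" "reach F s t" for s t
    proof -
      have "reach (insert e F) s t" using that(3) by (rule reach_mono) auto
      then show ?thesis
        using that c(2) insert.prems(5) by (metis insertE reach_sym)
    qed
  qed (use insert.prems in auto)
  moreover have "finite S" using insert.prems(1,4) by (rule finite_subset[rotated])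
  ultimately show ?case using \<open>c \<notin> S\<close> insert.hyps by simp
qed

text \<open>Given the domination conditions, the last two conditions say exactly that the edges outside
  \<open>F\<close> are located: the first of them deals with pairs sharing an end, the second with
  disjoint pairs.\<close>

definition valid :: "'a set set \<Rightarrow> 'a set set \<Rightarrow> bool" where
  "valid E F \<longleftrightarrow> F \<subseteq> E \<and> acyc F \<and>
     (\<forall>e\<in>F. \<exists>f\<in>F. f \<noteq> e \<and> e \<inter> f \<noteq> {}) \<and>
     (\<forall>e\<in>E. e \<inter> \<Union>F \<noteq> {}) \<and>
     (\<forall>u v y. {u, v} \<in> E \<longrightarrow> {u, y} \<in> E \<longrightarrow> v \<notin> \<Union>F \<longrightarrow> y \<notin> \<Union>F \<longrightarrow> v = y) \<and>
     (\<forall>e\<in>E - F. \<forall>f\<in>E - F. e \<inter> f = {} \<longrightarrow> (\<exists>g\<in>F. (g \<inter> e = {}) \<noteq> (g \<inter> f = {})))"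

lemma validI:
  assumes "F \<subseteq> E" "acyc F"
    and "\<And>e. e \<in> F \<Longrightarrow> \<exists>f\<in>F. f \<noteq> e \<and> e \<inter> f \<noteq> {}"
    and "\<And>e. e \<in> E \<Longrightarrow> e \<inter> \<Union>F \<noteq> {}"
    and "\<And>u v y. {u, v} \<in> E \<Longrightarrow> {u, y} \<in> E \<Longrightarrow> v \<notin> \<Union>F \<Longrightarrow> y \<notin> \<Union>F \<Longrightarrow> v = y"
    and "\<And>e f. e \<in> E - F \<Longrightarrow> f \<in> E - F \<Longrightarrow> e \<inter> f = {} \<Longrightarrow>
           (\<And>g. g \<in> F \<Longrightarrow> (g \<inter> e = {}) = (g \<inter> f = {})) \<Longrightarrow> False"
  shows "valid E F"
  unfolding valid_def
proof (intro conjI ballI allI impI)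
  show "\<exists>g\<in>F. (g \<inter> e = {}) \<noteq> (g \<inter> f = {})"
    if "e \<in> E - F" "f \<in> E - F" "e \<inter> f = {}" for e f
    using assms(6)[OF that] by blast
qed (fact assms)+

locale twin_free_graph =
  fixes E :: "'a set set"
  assumes fin: "finite E"
    and card2: "e \<in> E \<Longrightarrow> card e = 2"
    and twin_free: "edge_twin_free E"
    and no_isolated: "\<nexists>e. isolated_edge E e"
begin

lemma edge_neq: "{a, b} \<in> E \<Longrightarrow> a \<noteq> b"
  using card2[of "{a, b}"] by auto

lemma edge_at:
  assumes "e \<in> E" "a \<in> e"
  obtains b where "e = {a, b}" "a \<noteq> b"
  using card2[OF assms(1)] assms(2) unfolding card_2_iff by auto

lemma edge_ends:
  assumes "e \<in> E"
  obtains a b where "e = {a, b}" "a \<noteq> b"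
  using card2[OF assms] unfolding card_2_iff by auto

lemma adjacent_twins:
  assumes "{p, u} \<in> E" "{p, v} \<in> E" "u \<noteq> v" "nbrs E u \<subseteq> {p, v}" "nbrs E v \<subseteq> {p, u}"
  shows False
proof -
  have closed: "closed_edge_nbhd E e = {g \<in> E. g \<inter> e \<noteq> {}}" if "e \<in> E" for e
    using that card2[OF that] unfolding closed_edge_nbhd_def edge_nbhd_def by auto
  have sub: "{g \<in> E. g \<inter> {p, u} \<noteq> {}} \<subseteq> {g \<in> E. g \<inter> {p, v} \<noteq> {}}"
    if "nbrs E u \<subseteq> {p, v}" for u v
  proof clarify
    fix g assume g: "g \<in> E" "g \<inter> {p, u} \<noteq> {}" "g \<inter> {p, v} = {}"
    then have "u \<in> g" by blast
    then obtain k where "g = {u, k}" using edge_at g(1) by metis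
    then show False using g that unfolding nbrs_def by auto
  qed
  have "{p, u} \<noteq> {p, v}" using assms(3) by (auto simp: doubleton_eq_iff)
  moreover have "closed_edge_nbhd E {p, u} = closed_edge_nbhd E {p, v}"
    using closed assms(1,2) sub[OF assms(4)] sub[OF assms(5)] by auto
  ultimately show False
    using twin_free assms(1,2) unfolding edge_twin_free_def edge_twins_def by blast
qed

lemma not_isolated:
  assumes "{a, b} \<in> E"
  obtains v c where "v \<in> {a, b}" "{v, c} \<in> E" "c \<notin> {a, b}"
proof -
  obtain v where v: "v \<in> {a, b}" "card {f \<in> E. v \<in> f} \<noteq> 1"
    using no_isolated assms unfolding isolated_edge_def degree_def by blast
  have "{f \<in> E. v \<in> f} \<noteq> {{a, b}}"
  proof
    assume "{f \<in> E. v \<in> f} = {{a, b}}"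
    then show False using v(2) by simp
  qed
  then obtain f where f: "f \<in> E" "v \<in> f" "f \<noteq> {a, b}" using v(1) assms by blast
  then obtain c where c: "f = {v, c}" using edge_at by metis
  have "c \<noteq> v" using edge_neq f(1) c by blast
  then have "c \<notin> {a, b}" using c f(3) v(1) by auto
  then show ?thesis using that v(1) f(1) c by blast
qed

lemma valid_imp_elt:
  assumes "valid E F"
  shows "edge_locating_total_dominating E F"
proof -
  have sub: "F \<subseteq> E"
    and iso: "\<And>e. e \<in> F \<Longrightarrow> \<exists>f\<in>F. f \<noteq> e \<and> e \<inter> f \<noteq> {}"
    and dom: "\<And>e. e \<in> E \<Longrightarrow> e \<inter> \<Union>F \<noteq> {}"
    and unc: "\<And>u v y. {u, v} \<in> E \<Longrightarrow> {u, y} \<in> E \<Longrightarrow> v \<notin> \<Union>F \<Longrightarrow> y \<notin> \<Union>F \<Longrightarrow> v = y"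
    and sep: "\<And>e f. e \<in> E - F \<Longrightarrow> f \<in> E - F \<Longrightarrow> e \<inter> f = {} \<Longrightarrow>
                \<exists>g\<in>F. (g \<inter> e = {}) \<noteq> (g \<inter> f = {})"
    using assms unfolding valid_def by blast+
  have covered: "{v, y} \<in> F \<and> nbrs F v = {y}"
    if uv: "{u, v} \<in> E - F" and uy: "{u, y} \<in> E - F"
      and same: "\<And>g. g \<in> F \<Longrightarrow> (g \<inter> {u, v} = {}) = (g \<inter> {u, y} = {})"
      and "v \<noteq> y" "v \<in> \<Union>F" for u v y
  proof -
    have *: "w = y" if "{v, w} \<in> F" for w
      using same[OF that] uv that edge_neq[of u v] \<open>v \<noteq> y\<close> by (auto simp: insert_commute)
    obtain g where "g \<in> F" "v \<in> g" using \<open>v \<in> \<Union>F\<close> by blast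
    then obtain w where "{v, w} \<in> F" using edge_at sub by (metis subsetD)
    then show ?thesis using * unfolding nbrs_def by auto
  qed
  have meet: False
    if uv: "{u, v} \<in> E - F" and uy: "{u, y} \<in> E - F"
      and same: "\<And>g. g \<in> F \<Longrightarrow> (g \<inter> {u, v} = {}) = (g \<inter> {u, y} = {})"
      and vy: "v \<noteq> y" for u v y
  proof -
    note cv = covered[OF uv uy same vy]
    note cy = covered[OF uy uv same[symmetric] vy[symmetric]]
    have "v \<in> \<Union>F \<or> y \<in> \<Union>F" using unc uv uy vy by blast
    then have vyF: "{v, y} \<in> F" using cv cy by (auto simp: insert_commute)
    then have "v \<in> \<Union>F" "y \<in> \<Union>F" by auto
    then have nb: "nbrs F v = {y}" "nbrs F y = {v}" using cv cy by simp_all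
    obtain f where f: "f \<in> F" "f \<noteq> {v, y}" "{v, y} \<inter> f \<noteq> {}" using iso[OF vyF] by blast
    then consider "v \<in> f" | "y \<in> f" by blast
    then show False
    proof cases
      case 1
      then obtain k where "f = {v, k}" using edge_at f sub by (metis subsetD)
      then show False using nb f by (auto simp: nbrs_def)
    next
      case 2
      then obtain k where "f = {y, k}" using edge_at f sub by (metis subsetD)
      then show False using nb f by (auto simp: nbrs_def)
    qed
  qed
  show ?thesis
    unfolding edge_locating_total_dominating_def
  proof (intro conjI ballI impI notI)
    show "F \<subseteq> E" by (rule sub)
    show "\<exists>f\<in>F. f \<noteq> e \<and> e \<inter> f \<noteq> {}" if "e \<in> E" for e
    proof (cases "e \<in> F")
      case True
      then show ?thesis by (rule iso)
    next
      case False
      moreover obtain f where "f \<in> F" "e \<inter> f \<noteq> {}" using dom[OF \<open>e \<in> E\<close>] by auto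
      ultimately show ?thesis by metis
    qed
  next
    fix e f
    assume e: "e \<in> E - F" and f: "f \<in> E - F" and "e \<noteq> f"
      and eq: "edge_nbhd E e \<inter> F = edge_nbhd E f \<inter> F"
    have same: "(g \<inter> e = {}) = (g \<inter> f = {})" if "g \<in> F" for g
    proof -
      have "g \<in> edge_nbhd E e \<longleftrightarrow> g \<in> edge_nbhd E f" using eq that by blast
      moreover have "g \<in> E" "g \<noteq> e" "g \<noteq> f" using that e f sub by auto
      ultimately show ?thesis by (auto simp: edge_nbhd_def Int_commute)
    qed
    show False
    proof (cases "e \<inter> f = {}")
      case True
      then show False using sep[OF e f] same by blast
    next
      case False
      then obtain u where u: "u \<in> e" "u \<in> f" by blast
      then obtain v y where vy: "e = {u, v}" "f = {u, y}" using edge_at e f by (metis DiffD1)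
      then show False using meet e f same \<open>e \<noteq> f\<close> by blast
    qed
  qed
qed

text \<open>A minimum spanning forest works: it covers every vertex, and two disjoint edges that it does not
  separate would be twins in a component with four vertices.\<close>

lemma valid_exists: "\<exists>F. valid E F"
proof -
  define P where "P F \<longleftrightarrow> F \<subseteq> E \<and> (\<forall>a b. {a, b} \<in> E \<longrightarrow> reach F a b)" for F
  have "P E" by (auto simp: P_def intro: reach_edge)
  from ex_has_least_nat[of P, OF this, of card]
  obtain F where PF: "P F" and min: "\<And>F'. P F' \<Longrightarrow> card F \<le> card F'" by blast
  have sub: "F \<subseteq> E" and span: "\<And>a b. {a, b} \<in> E \<Longrightarrow> reach F a b"
    using PF by (auto simp: P_def)
  have finF: "finite F" using sub fin by (rule finite_subset)
  have lift: "b \<in> B" if "{a, b} \<in> E" "a \<in> B" "\<And>x y. x \<in> B \<Longrightarrow> {x, y} \<in> F \<Longrightarrow> y \<in> B" for a b B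
    using span[OF that(1)] that(2,3) by (rule reach_closed)
  have cov: "a \<in> \<Union>F" if "{a, b} \<in> E" for a b
  proof (rule ccontr)
    assume "a \<notin> \<Union>F"
    then have "b \<in> {a}" using that by (intro lift[of a b "{a}"]) auto
    then show False using edge_neq[OF that] by simp
  qed
  have "valid E F"
  proof (rule validI)
    show "F \<subseteq> E" by (rule sub)
    show "acyc F"
      unfolding acyc_def
    proof (intro allI impI notI)
      fix a b assume ab: "{a, b} \<in> F" and r: "reach (F - {{a, b}}) a b"
      let ?F = "F - {{a, b}}"
      have step: "reach ?F c d" if "{c, d} \<in> F" for c d
      proof (cases "{c, d} = {a, b}")
        case True
        then show ?thesis using r reach_sym[OF r] by (auto simp: doubleton_eq_iff)
      next
        case False
        then show ?thesis using that by (intro reach_edge) auto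
      qed
      have "reach ?F c d" if "reach F c d" for c d
        using that by (induction rule: reach_induct) (auto intro: reach_trans step)
      then have "P ?F" using sub span by (auto simp: P_def)
      then have "card F \<le> card ?F" by (rule min)
      then show False using ab finF card_Diff1_less[of F] by (meson not_le)
    qed
    show "\<exists>f\<in>F. f \<noteq> e \<and> e \<inter> f \<noteq> {}" if "e \<in> F" for e
    proof (rule ccontr)
      assume no: "\<not> ?thesis"
      have eE: "e \<in> E" using that sub by blast
      obtain a b where ab: "e = {a, b}" using edge_ends[OF eE] by metis
      obtain v c where vc: "v \<in> {a, b}" "{v, c} \<in> E" "c \<notin> {a, b}"
        using not_isolated eE unfolding ab by metis
      have "c \<in> {a, b}"
      proof (rule lift[OF vc(2,1)])
        fix x y assume x: "x \<in> {a, b}" and "{x, y} \<in> F"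
        moreover have "e \<inter> {x, y} \<noteq> {}" using x ab by auto
        ultimately have "{x, y} = {a, b}" using no ab by metis
        then show "y \<in> {a, b}" by (auto simp: doubleton_eq_iff)
      qed
      then show False using vc by blast
    qed
    show "e \<inter> \<Union>F \<noteq> {}" if "e \<in> E" for e
    proof -
      obtain a b where "e = {a, b}" using edge_ends[OF \<open>e \<in> E\<close>] .
      then show ?thesis using cov[of a b] that by auto
    qed
    show "v = y" if "{u, v} \<in> E" "{u, y} \<in> E" "v \<notin> \<Union>F" for u v y
      using cov[of v u] that by (simp add: insert_commute)
    fix e f
    assume e: "e \<in> E - F" and f: "f \<in> E - F" and dj: "e \<inter> f = {}"
      and same: "\<And>g. g \<in> F \<Longrightarrow> (g \<inter> e = {}) = (g \<inter> f = {})"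
    have cross: "y \<in> e \<union> f" if "{x, y} \<in> F" "x \<in> e \<union> f" for x y
      using same[OF that(1)] that(2) dj by auto
    have nbhd: "edge_nbhd E e \<subseteq> edge_nbhd E f"
      if "e \<in> E" and ef: "e \<inter> f = {}"
        and closed: "\<And>x y. {x, y} \<in> F \<Longrightarrow> x \<in> e \<union> f \<Longrightarrow> y \<in> e \<union> f" for e f
    proof
      fix g assume "g \<in> edge_nbhd E e"
      then obtain a where g: "g \<in> E" "g \<noteq> e" "a \<in> e" "a \<in> g" unfolding edge_nbhd_def by blast
      then obtain b where b: "g = {a, b}" "a \<noteq> b" using edge_at by metis
      have "b \<in> e \<union> f"
      proof (rule lift)
        show "{a, b} \<in> E" using g(1) b(1) by simp
        show "a \<in> e \<union> f" using g(3) by simp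
        show "y \<in> e \<union> f" if "x \<in> e \<union> f" "{x, y} \<in> F" for x y
          using closed that by blast
      qed
      moreover obtain a' where "e = {a, a'}" using edge_at[OF \<open>e \<in> E\<close> g(3)] by metis
      ultimately have "b \<in> f" using g(2) b by auto
      then show "g \<in> edge_nbhd E f"
        using g b ef unfolding edge_nbhd_def by auto
    qed
    have "edge_nbhd E e \<subseteq> edge_nbhd E f" using e dj cross by (intro nbhd) auto
    moreover have "edge_nbhd E f \<subseteq> edge_nbhd E e"
      using f dj cross by (intro nbhd) (auto simp: Un_commute)
    moreover have "e \<noteq> f" using dj e card2[of e] by auto
    ultimately show False
      using twin_free e f unfolding edge_twin_free_def edge_twins_def by blast
  qed
  then show ?thesis by (rule exI)
qed

end

subsection \<open>Minimal sets and their weights\<close>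

text \<open>The second condition, that among smallest sets \<^term>\<open>D\<close> covers fewest vertices, is needed
  only for components that are paths with two edges.\<close>

locale minimal_valid = twin_free_graph E for E :: "'a set set" +
  fixes D :: "'a set set"
  assumes validD: "valid E D"
    and min_card: "valid E F \<Longrightarrow> card D \<le> card F"
    and min_cover: "valid E F \<Longrightarrow> card F = card D \<Longrightarrow> card (\<Union>D) \<le> card (\<Union>F)"
begin

lemma D_sub: "D \<subseteq> E"
  and D_acyc: "acyc D"
  and D_iso: "e \<in> D \<Longrightarrow> \<exists>f\<in>D. f \<noteq> e \<and> e \<inter> f \<noteq> {}"
  and D_dom: "e \<in> E \<Longrightarrow> e \<inter> \<Union>D \<noteq> {}"
  and D_unc: "{u, v} \<in> E \<Longrightarrow> {u, y} \<in> E \<Longrightarrow> v \<notin> \<Union>D \<Longrightarrow> y \<notin> \<Union>D \<Longrightarrow> v = y"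
  and D_sep: "e \<in> E - D \<Longrightarrow> f \<in> E - D \<Longrightarrow> e \<inter> f = {} \<Longrightarrow>
                \<exists>g\<in>D. (g \<inter> e = {}) \<noteq> (g \<inter> f = {})"
  using validD unfolding valid_def by simp_all

lemma D_edge: "{a, b} \<in> D \<Longrightarrow> {a, b} \<in> E"
  using D_sub by blast

lemma D_neq: "{a, b} \<in> D \<Longrightarrow> a \<noteq> b"
  using D_edge edge_neq by blast

lemma fin_D: "finite D"
  using D_sub fin by (rule finite_subset)

lemma fin_edge: "e \<in> E \<Longrightarrow> finite e"
  using card2[of e] card_ge_0_finite[of e] by simp

lemma fin_cov: "finite (\<Union>D)"
  using fin_D D_sub by (intro finite_Union) (auto intro: fin_edge)

lemma cov_iff: "v \<in> \<Union>D \<longleftrightarrow> (\<exists>u. {v, u} \<in> D)"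
  using edge_at D_sub by (metis UnionE UnionI insertI1 subsetD)

lemma fin_nbrs: "F \<subseteq> E \<Longrightarrow> finite (nbrs F v)"
proof -
  assume "F \<subseteq> E"
  then have "nbrs F v \<subseteq> \<Union>E" by (auto simp: nbrs_def)
  moreover have "finite (\<Union>E)"
    using fin by (intro finite_Union) (auto intro: fin_edge)
  ultimately show ?thesis by (rule finite_subset)
qed

definition leaf :: "'a \<Rightarrow> bool" where
  "leaf v \<longleftrightarrow> (\<exists>p. nbrs D v = {p})"

text \<open>The recipients of charge are chosen so that deleting a leaf edge can fail only if the leaf has
  weight at least 2 or its neighbour is rich: a rich vertex admits no second uncovered neighbour,
  and a special vertex \<open>x\<close> admits none, since an edge from \<open>x\<close> to it would not be separated
  from \<open>uv\<close>.\<close>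

definition rich :: "'a \<Rightarrow> bool" where
  "rich v \<longleftrightarrow> v \<in> \<Union>D \<and> (\<exists>y. {v, y} \<in> E \<and> y \<notin> \<Union>D)"

definition special :: "'a \<Rightarrow> bool" where
  "special x \<longleftrightarrow> (\<exists>u v. u \<noteq> v \<and> nbrs D x = {u, v} \<and> nbrs D u = {x} \<and> nbrs D v = {x} \<and> {u, v} \<in> E)"

text \<open>\<open>share a b\<close> is what \<open>a\<close> receives from the edge \<open>ab\<close> of \<^term>\<open>E - D\<close>: the
  two ends together receive at most 2, and rich and special vertices pass on their part.\<close>

definition share :: "'a \<Rightarrow> 'a \<Rightarrow> nat" where
  "share a b = (if a \<notin> \<Union>D then 0 else if b \<notin> \<Union>D then 2
     else if rich a \<or> special a then 0 else if rich b \<or> special b then 2 else 1)"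

definition weight :: "'a \<Rightarrow> nat" where
  "weight v = (\<Sum>b\<in>nbrs (E - D) v. share v b)"

lemma share_le_weight: "{v, b} \<in> E - D \<Longrightarrow> share v b \<le> weight v"
  unfolding weight_def by (rule member_le_sum) (auto intro: fin_nbrs)

lemma weight_rich: "rich v \<Longrightarrow> 2 \<le> weight v"
proof -
  assume "rich v"
  then obtain y where y: "v \<in> \<Union>D" "{v, y} \<in> E" "y \<notin> \<Union>D" unfolding rich_def by blast
  then have "{v, y} \<in> E - D" by auto
  from share_le_weight[OF this] show ?thesis
    unfolding share_def using y(1,3) by (simp only: if_True if_False not_True_eq_False simp_thms)
qed

lemma weight_giver:
  assumes "v \<in> \<Union>D" "\<not> special v" "{v, y} \<in> E - D" "rich y \<or> special y"
  shows "2 \<le> weight v"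
proof (cases "rich v")
  case True
  then show ?thesis by (rule weight_rich)
next
  case False
  then show ?thesis
    using share_le_weight[OF assms(3)] assms by (simp add: share_def split: if_splits)
qed

lemma weight_card:
  assumes "v \<in> \<Union>D" "\<not> special v" "weight v \<le> 1"
  shows "card (nbrs (E - D) v) \<le> weight v"
proof -
  have "\<not> rich v" using weight_rich[of v] assms(3) by linarith
  then have "1 \<le> share v b" for b using assms by (simp add: share_def)
  then have "(\<Sum>b\<in>nbrs (E - D) v. 1) \<le> weight v" unfolding weight_def by (intro sum_mono)
  then show ?thesis by simp
qed

lemma weight_0:
  assumes "v \<in> \<Union>D" "\<not> special v" "weight v = 0"
  shows "nbrs (E - D) v = {}"
  using weight_card[OF assms(1,2)] assms(3) fin_nbrs[of "E - D" v] by auto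

lemma weight_pos: "v \<in> \<Union>D \<Longrightarrow> \<not> special v \<Longrightarrow> {v, y} \<in> E - D \<Longrightarrow> 1 \<le> weight v"
  using weight_0[of v] by (metis empty_iff less_one nbrs_iff not_le)

lemma sum_weight: "(\<Sum>v\<in>\<Union>D. weight v) \<le> 2 * card (E - D)"
proof -
  let ?P = "Sigma (\<Union>D) (nbrs (E - D))"
  have finP: "finite ?P" using fin_cov fin_nbrs by blast
  have "(\<Sum>v\<in>\<Union>D. weight v) = (\<Sum>(v, b)\<in>?P. share v b)"
    unfolding weight_def using fin_cov fin_nbrs by (intro sum.Sigma) auto
  also have "\<dots> = (\<Sum>g\<in>E - D. \<Sum>(v, b)\<in>{x \<in> ?P. {fst x, snd x} = g}. share v b)"
    using finP fin by (intro sum.group[symmetric]) auto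
  also have "\<dots> \<le> (\<Sum>g\<in>E - D. 2)"
  proof (rule sum_mono)
    fix g assume "g \<in> E - D"
    then obtain a b where g: "g = {a, b}" "a \<noteq> b" using edge_ends by blast
    have "{x \<in> ?P. {fst x, snd x} = g} \<subseteq> {(a, b), (b, a)}"
      using g by (auto simp: doubleton_eq_iff)
    then have "(\<Sum>(v, b)\<in>{x \<in> ?P. {fst x, snd x} = g}. share v b)
        \<le> (\<Sum>(v, b)\<in>{(a, b), (b, a)}. share v b)"
      by (intro sum_mono2) auto
    also have "\<dots> = share a b + share b a" using g(2) by simp
    also have "\<dots> \<le> 2" by (simp add: share_def)
    finally show "(\<Sum>(v, b)\<in>{x \<in> ?P. {fst x, snd x} = g}. share v b) \<le> 2" .
  qed
  finally show ?thesis by simp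
qed

lemma leafD: "leaf l \<Longrightarrow> {l, a} \<in> D \<Longrightarrow> {l, b} \<in> D \<Longrightarrow> a = b"
  unfolding leaf_def by (metis nbrs_iff singletonD)

lemma leaf_nbrs: "leaf l \<Longrightarrow> {l, a} \<in> D \<Longrightarrow> nbrs D l = {a}"
  unfolding leaf_def by (metis nbrs_iff singletonD)

lemma not_leaf_ex:
  assumes "\<not> leaf v" "{v, a} \<in> D"
  obtains b where "{v, b} \<in> D" "b \<noteq> a"
proof -
  have "nbrs D v \<noteq> {a}" using assms(1) leaf_def by blast
  then obtain b where "b \<in> nbrs D v" "b \<noteq> a" using assms(2) nbrs_iff[of a D v] by blast
  then show ?thesis using that by simp
qed

lemma special_reach:
  assumes "special x" "reach D x z"
  shows "z = x \<or> leaf z \<and> nbrs D x = {z, the_elem (nbrs D x - {z})} \<and> leaf (the_elem (nbrs D x - {z}))"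
proof -
  obtain u v where uv: "u \<noteq> v" "nbrs D x = {u, v}" "nbrs D u = {x}" "nbrs D v = {x}"
    using assms(1) unfolding special_def by blast
  have closed: "b \<in> {x, u, v}" if "a \<in> {x, u, v}" "{a, b} \<in> D" for a b
    using that uv(2-4) nbrs_iff[of b D a] by auto
  have "z \<in> {x, u, v}"
    by (rule reach_closed[OF assms(2)]) (use closed in auto)
  moreover have "{u, v} - {v} = {u}" "{u, v} - {u} = {v}" using uv(1) by auto
  ultimately show ?thesis
    using uv by (auto simp: leaf_def)
qed

lemma special_not_leaf: "special x \<Longrightarrow> \<not> leaf x"
  unfolding special_def leaf_def by (metis doubleton_eq_iff insert_absorb2)

lemma reach_cov: "reach D a b \<Longrightarrow> a \<in> \<Union>D \<Longrightarrow> b \<in> \<Union>D"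
  by (erule reach_closed) blast+

lemma D_parent_nonleaf:
  assumes "{l, p} \<in> D" "leaf l"
  shows "\<not> leaf p"
proof
  assume "leaf p"
  have nb: "nbrs D l = {p}" "nbrs D p = {l}"
    using assms \<open>leaf p\<close> leaf_nbrs by (auto simp: insert_commute)
  obtain f where f: "f \<in> D" "f \<noteq> {l, p}" "{l, p} \<inter> f \<noteq> {}" using D_iso[OF assms(1)] by blast
  then obtain a where a: "a \<in> {l, p}" "a \<in> f" by blast
  then obtain k where "f = {a, k}" using edge_at f(1) D_sub by (metis subsetD)
  then have "k \<in> nbrs D a" using f(1) by simp
  then show False using a(1) nb f(2) \<open>f = {a, k}\<close> by auto
qed

lemma leaf_twins:
  assumes "{p, u} \<in> D" "{p, v} \<in> D" "u \<noteq> v" "leaf u" "leaf v"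
    "nbrs (E - D) u \<subseteq> {v}" "nbrs (E - D) v \<subseteq> {u}"
  shows False
proof (rule adjacent_twins)
  show "{p, u} \<in> E" "{p, v} \<in> E" using assms D_edge by auto
  have *: "nbrs E a = nbrs D a \<union> nbrs (E - D) a" for a using D_sub by auto
  have "nbrs D u = {p}" "nbrs D v = {p}"
    using assms by (auto intro!: leaf_nbrs simp: insert_commute)
  then show "nbrs E u \<subseteq> {p, v}" "nbrs E v \<subseteq> {p, u}" using assms(6,7) unfolding * by auto
qed (rule assms(3))

text \<open>Replacing \<open>xv\<close> by \<open>uz\<close> keeps the size and uncovers \<open>v\<close>.\<close>

lemma swap_contradiction:
  assumes x: "nbrs E x = {u, v}" and nu: "nbrs D u = {x}" and nv: "nbrs E v = {x}"
    and xu: "{x, u} \<in> D" and xv: "{x, v} \<in> D" and "u \<noteq> v"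
    and uz: "{u, z} \<in> E - D" and z: "z \<in> \<Union>D"
  shows False
proof -
  define F where "F = insert {u, z} (D - {{x, v}})"
  have F_iff: "g \<in> F \<longleftrightarrow> g = {u, z} \<or> g \<in> D \<and> g \<noteq> {x, v}" for g by (auto simp: F_def)
  have neq: "x \<noteq> u" "x \<noteq> v" "u \<noteq> z" using xu xv uz edge_neq D_neq by auto
  have ux: "{u, x} \<in> D" using xu by (simp add: insert_commute)
  have z_notin: "z \<notin> {x, u, v}"
  proof
    assume "z \<in> {x, u, v}"
    moreover have "z \<noteq> x" using uz ux by blast
    moreover have "z \<noteq> v"
    proof
      assume "z = v"
      then have "u \<in> nbrs E v" using uz by (simp add: insert_commute)
      then show False using nv neq by auto
    qed
    ultimately show False using neq by auto
  qed
  have Dx: "b \<in> {u, v}" if "{x, b} \<in> D" for b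
    using that D_edge[OF that] x nbrs_iff[of b E x] by auto
  have Dv: "b = x" if "{v, b} \<in> D" for b
    using that D_edge[OF that] nv nbrs_iff[of b E v] by auto
  have Du: "b = x" if "{u, b} \<in> D" for b
    using that nu nbrs_iff[of b D u] by auto
  have covF: "\<Union>F = \<Union>D - {v}"
  proof
    show "\<Union>F \<subseteq> \<Union>D - {v}"
    proof
      fix a assume "a \<in> \<Union>F"
      then consider "a \<in> {u, z}" | g where "g \<in> D" "g \<noteq> {x, v}" "a \<in> g"
        unfolding F_def by blast
      then show "a \<in> \<Union>D - {v}"
      proof cases
        case 1
        then show ?thesis using z xu z_notin \<open>u \<noteq> v\<close> by auto
      next
        case 2
        have "a \<noteq> v"
        proof
          assume "a = v"
          then obtain k where k: "g = {v, k}" using edge_at 2 D_sub by (metis subsetD)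
          then show False using Dv[of k] 2 by (auto simp: insert_commute)
        qed
        then show ?thesis using 2 by blast
      qed
    qed
    show "\<Union>D - {v} \<subseteq> \<Union>F"
    proof
      fix a assume a: "a \<in> \<Union>D - {v}"
      then obtain g where g: "g \<in> D" "a \<in> g" by blast
      show "a \<in> \<Union>F"
      proof (cases "g = {x, v}")
        case True
        then have "a = x" using a g by auto
        moreover have "{x, u} \<in> F" using xu \<open>u \<noteq> v\<close> by (auto simp: F_iff doubleton_eq_iff)
        ultimately show ?thesis by blast
      next
        case False
        then have "g \<in> F" using g(1) F_iff[of g] by simp
        then show ?thesis using g by blast
      qed
    qed
  qed
  have "card F = card D"
    using uz xv fin_D card_Suc_Diff1[of D "{x, v}"] by (simp add: F_def)
  have "\<not> reach D u z"
  proof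
    assume "reach D u z"
    then have "z \<in> {x, u, v}"
      by (rule reach_closed) (use Dx Dv Du in auto)
    then show False using z_notin by blast
  qed
  then have "\<not> reach (D - {{x, v}}) u z" using reach_mono[of "D - {{x, v}}" u z D] by auto
  have F_sub: "F \<subseteq> E" using D_sub uz by (auto simp: F_iff)
  have "valid E F"
  proof (rule validI)
    show "F \<subseteq> E" by (rule F_sub)
    show "acyc F"
      unfolding F_def using acyc_mono[OF D_acyc, of "D - {{x, v}}"] \<open>\<not> reach (D - {{x, v}}) u z\<close>
      by (intro acyc_insert) auto
  next
    fix e assume "e \<in> F"
    have uxF: "{u, x} \<in> F" "{u, z} \<in> F"
      using ux \<open>u \<noteq> v\<close> neq by (auto simp: F_iff doubleton_eq_iff)
    have ne: "{u, x} \<noteq> {u, z}" using z_notin by (auto simp: doubleton_eq_iff)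
    consider "e = {u, z}" | "e = {u, x}" | "e \<in> D" "x \<notin> e"
    proof (cases "x \<in> e")
      case True
      then obtain k where k: "e = {x, k}" using edge_at \<open>e \<in> F\<close> F_sub by (metis subsetD)
      have "e \<noteq> {u, z}" using True z_notin neq by auto
      then have "e \<in> D" "e \<noteq> {x, v}" using \<open>e \<in> F\<close> F_iff[of e] by simp_all
      then have "k = u" using Dx[of k] k by auto
      then show ?thesis using k that(2) by (simp add: insert_commute)
    next
      case False
      then show ?thesis using that(1,3) \<open>e \<in> F\<close> F_iff[of e] by metis
    qed
    then show "\<exists>f\<in>F. f \<noteq> e \<and> e \<inter> f \<noteq> {}"
    proof cases
      case 1
      then show ?thesis using uxF ne by (intro bexI[of _ "{u, x}"]) auto
    next
      case 2
      then show ?thesis using uxF ne by (intro bexI[of _ "{u, z}"]) auto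
    next
      case 3
      obtain f where f: "f \<in> D" "f \<noteq> e" "e \<inter> f \<noteq> {}" using D_iso[OF 3(1)] by blast
      have "f \<noteq> {x, v}"
      proof
        assume "f = {x, v}"
        then have "v \<in> e" using f(3) 3(2) by auto
        then obtain k where k: "e = {v, k}" using edge_at 3(1) D_sub by (metis subsetD)
        then show False using Dv[of k] 3 by auto
      qed
      then have "f \<in> F" using f(1) F_iff[of f] by simp
      then show ?thesis using f(2,3) by metis
    qed
  next
    fix e assume e: "e \<in> E"
    show "e \<inter> \<Union>F \<noteq> {}"
    proof (cases "v \<in> e")
      case True
      then obtain k where k: "e = {v, k}" using edge_at e by metis
      then have "k \<in> nbrs E v" using e by simp
      then have "x \<in> e" using k nv by simp
      moreover have "x \<in> \<Union>F" unfolding covF using xu neq by auto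
      ultimately show ?thesis by blast
    next
      case False
      then show ?thesis unfolding covF using D_dom[OF e] by blast
    qed
  next
    have *: "y = v" if "{a, v} \<in> E" "{a, y} \<in> E" "y \<notin> \<Union>D" for a y
    proof -
      have "a \<in> nbrs E v" using that by (simp add: insert_commute)
      then have "a = x" using nv by simp
      then have "y \<in> nbrs E x" using that by simp
      then have "y \<in> {u, v}" using x by simp
      then show ?thesis using that(3) xu xv by auto
    qed
    fix a b y
    assume "{a, b} \<in> E" "{a, y} \<in> E" "b \<notin> \<Union>F" "y \<notin> \<Union>F"
    then show "b = y" unfolding covF using *[of a y] *[of a b] D_unc[of a b y] by auto
  next
    fix e f
    assume e: "e \<in> E - F" and f: "f \<in> E - F" and dj: "e \<inter> f = {}"
      and same: "\<And>g. g \<in> F \<Longrightarrow> (g \<inter> e = {}) = (g \<inter> f = {})"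
    have cross: "b \<in> e \<union> f" if "{a, b} \<in> F" "a \<in> e \<union> f" for a b
      using same[OF that(1)] that(2) dj by auto
    have ux': "{u, x} \<in> F" "{x, u} \<in> F"
      using ux xu \<open>u \<noteq> v\<close> neq by (auto simp: F_iff doubleton_eq_iff)
    have uz': "{u, z} \<in> F" "{z, u} \<in> F" by (auto simp: F_iff insert_commute)
    show False
    proof (cases "u \<in> e \<union> f")
      case True
      have "x \<in> e \<union> f" "z \<in> e \<union> f" using True cross ux' uz' by blast+
      obtain z' where z': "{z, z'} \<in> D" using z cov_iff by blast
      have z'_neq: "z' \<notin> {x, u, v, z}"
      proof -
        have "{z', z} \<in> D" using z' by (simp add: insert_commute)
        then have "z' \<notin> {x, u, v}" using Dx[of z] Du[of z] Dv[of z] z_notin by auto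
        then show ?thesis using z' D_neq by auto
      qed
      have inF: "{a, b} \<in> F" if "{a, b} \<in> D" "a \<notin> {x, v}" for a b
        using that by (auto simp: F_iff doubleton_eq_iff)
      have "z' \<in> e \<union> f" using \<open>z \<in> e \<union> f\<close> cross inF[OF z'] z_notin by blast
      obtain g where g: "g \<in> D" "g \<noteq> {z, z'}" "{z, z'} \<inter> g \<noteq> {}" using D_iso[OF z'] by blast
      then obtain a where a: "a \<in> {z, z'}" "a \<in> g" by blast
      obtain z'' where z'': "g = {a, z''}" using edge_at g(1) D_sub a(2) by (metis subsetD)
      have "z'' \<noteq> u" "z'' \<noteq> x"
        using Du[of a] Dx[of a] g(1) z'' a z'_neq z_notin by (auto simp: insert_commute)
      moreover have "z'' \<notin> {z, z'}"
        using g(1,2) z'' a(1) D_neq by (auto simp: insert_commute)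
      moreover have "z'' \<in> e \<union> f"
      proof (rule cross)
        show "{a, z''} \<in> F" using a z_notin z'_neq g(1) z'' by (intro inF) auto
        show "a \<in> e \<union> f" using a \<open>z \<in> e \<union> f\<close> \<open>z' \<in> e \<union> f\<close> by blast
      qed
      moreover have "x \<notin> {u, z, z'}" "u \<notin> {z, z'}" "z \<noteq> z'" using neq z_notin z'_neq by auto
      ultimately have "card {z'', x, u, z, z'} = 5" by simp
      moreover have "{z'', x, u, z, z'} \<subseteq> e \<union> f"
        using True \<open>x \<in> e \<union> f\<close> \<open>z \<in> e \<union> f\<close> \<open>z' \<in> e \<union> f\<close> \<open>z'' \<in> e \<union> f\<close> by simp
      moreover have "card (e \<union> f) = 4" "finite (e \<union> f)"
        using e f dj card2[of e] card2[of f] card_Un_disjoint[of e f] by (auto intro: fin_edge)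
      ultimately show False using card_mono[of "e \<union> f" "{z'', x, u, z, z'}"] by simp
    next
      case False
      have "x \<notin> e \<union> f" using False cross ux' by blast
      have "v \<notin> h" if h: "h \<in> E" "x \<notin> h" for h
      proof
        assume "v \<in> h"
        then obtain k where k: "h = {v, k}" using edge_at[OF h(1)] by metis
        then have "k \<in> nbrs E v" using h by simp
        then show False using k nv h by simp
      qed
      then have "{x, v} \<inter> e = {}" "{x, v} \<inter> f = {}" using \<open>x \<notin> e \<union> f\<close> e f by auto
      then have "(g \<inter> e = {}) = (g \<inter> f = {})" if "g \<in> D" for g
        using that same[of g] F_iff[of g] by (cases "g = {x, v}") auto
      moreover have "e \<notin> D" "f \<notin> D"
        using e f \<open>x \<notin> e \<union> f\<close> F_iff by auto
      ultimately show False using D_sep[of e f] e f dj by blast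
    qed
  qed
  then have "card (\<Union>D) \<le> card (\<Union>F)"
    using \<open>card F = card D\<close> by (rule min_cover)
  moreover have "v \<in> \<Union>D" using xv by blast
  ultimately show False
    unfolding covF using fin_cov card_Diff1_less[of "\<Union>D" v] by linarith
qed


subsection \<open>Deleting an edge of a minimal set\<close>

definition comp :: "'a \<Rightarrow> 'a set" where
  "comp v = {z. reach D v z}"

lemma comp_eq:
  assumes "z \<in> comp v"
  shows "comp z = comp v"
proof -
  have r: "reach D v z" using assms by (simp add: comp_def)
  have "reach D z w \<longleftrightarrow> reach D v w" for w
    using reach_trans[OF r] reach_trans[OF reach_sym[OF r]] by blast
  then show ?thesis by (simp add: comp_def)
qed

lemma comp_cov:
  assumes "v \<in> \<Union>D"
  shows "comp v \<subseteq> \<Union>D"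
proof
  fix z assume "z \<in> comp v"
  then have "reach D v z" by (simp add: comp_def)
  then show "z \<in> \<Union>D" using assms by (rule reach_cov)
qed

lemma fin_comp: "v \<in> \<Union>D \<Longrightarrow> finite (comp v)"
  using comp_cov fin_cov by (rule finite_subset)

lemma comp_bound:
  assumes "finite C" "l \<in> C" "\<And>z. z \<in> C \<Longrightarrow> z \<noteq> l \<Longrightarrow> 1 \<le> weight z"
  shows "card C \<le> (\<Sum>z\<in>C. weight z) + 1"
proof -
  have "(\<Sum>z\<in>C - {l}. 1) \<le> (\<Sum>z\<in>C - {l}. weight z)"
    using assms(3) by (intro sum_mono) auto
  also have "\<dots> \<le> (\<Sum>z\<in>C. weight z)"
    using assms(1) by (intro sum_mono2) auto
  finally show ?thesis using assms(1,2) by simp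
qed

text \<open>Deleting an internal edge of \<^term>\<open>D\<close> covers the same vertices, so it can only fail by
  cutting off a single edge, or by leaving two unseparated edges of \<^term>\<open>E - D\<close> which then
  span the whole component of one side.\<close>

lemma internal_edge:
  assumes ab: "{a, b} \<in> D" "\<not> leaf a" "\<not> leaf b"
  shows "\<exists>s\<in>{a, b}.
    (\<exists>l. {s, l} \<in> D \<and> leaf l \<and> (\<forall>z. reach (D - {{a, b}}) s z \<longrightarrow> z \<in> {s, l})) \<or>
    (\<forall>z. reach (D - {{a, b}}) s z \<longrightarrow> 1 \<le> weight z)"
proof -
  define F where "F = D - {{a, b}}"
  have F_iff: "g \<in> F \<longleftrightarrow> g \<in> D \<and> g \<noteq> {a, b}" for g by (auto simp: F_def)
  obtain a' where a': "{a, a'} \<in> D" "a' \<noteq> b" using not_leaf_ex[OF ab(2,1)] by blast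
  obtain b' where b': "{b, b'} \<in> D" "b' \<noteq> a"
    using not_leaf_ex[OF ab(3), of a] ab(1) by (auto simp: insert_commute)
  have "a \<noteq> b" using ab(1) D_neq by blast
  have F_sub: "F \<subseteq> D" by (auto simp: F_def)
  have F_edge: "g \<in> E" if "g \<in> F" for g using that F_sub D_sub by blast
  have aF: "{a, a'} \<in> F" using a' \<open>a \<noteq> b\<close> by (auto simp: F_iff doubleton_eq_iff)
  have bF: "{b, b'} \<in> F" using b' \<open>a \<noteq> b\<close> by (auto simp: F_iff doubleton_eq_iff)
  have bridge: "\<not> reach F a b" using D_acyc ab(1) unfolding acyc_def F_def by simp
  have "{a, b} \<subseteq> \<Union>F" using aF bF by blast
  moreover have "g \<subseteq> {a, b} \<union> \<Union>F" if "g \<in> D" for g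
    using that F_iff[of g] by (cases "g = {a, b}") auto
  ultimately have covF: "\<Union>F = \<Union>D" using F_sub by blast
  have "card F < card D" unfolding F_def using ab(1) fin_D by (intro card_Diff1_less)
  then have "\<not> valid E F" using min_card leD by blast
  have valid: "valid E F"
    if "\<And>e. e \<in> F \<Longrightarrow> \<exists>f\<in>F. f \<noteq> e \<and> e \<inter> f \<noteq> {}"
      and "\<And>e f. e \<in> E - F \<Longrightarrow> f \<in> E - F \<Longrightarrow> e \<inter> f = {} \<Longrightarrow>
           (\<And>g. g \<in> F \<Longrightarrow> (g \<inter> e = {}) = (g \<inter> f = {})) \<Longrightarrow> False"
  proof (rule validI)
    show "F \<subseteq> E" using F_edge by blast
    show "acyc F" using D_acyc F_sub by (rule acyc_mono)
    show "e \<inter> \<Union>F \<noteq> {}" if "e \<in> E" for e unfolding covF using that by (rule D_dom)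
    show "v = y" if "{u, v} \<in> E" "{u, y} \<in> E" "v \<notin> \<Union>F" "y \<notin> \<Union>F" for u v y
      using that unfolding covF by (rule D_unc)
  qed (fact that)+
  have "\<exists>s\<in>{a, b}. (\<exists>l. {s, l} \<in> D \<and> leaf l \<and> (\<forall>z. reach F s z \<longrightarrow> z \<in> {s, l})) \<or>
    (\<forall>z. reach F s z \<longrightarrow> 1 \<le> weight z)"
  proof (cases "\<forall>e\<in>F. \<exists>f\<in>F. f \<noteq> e \<and> e \<inter> f \<noteq> {}")
    case False
    then obtain g where g: "g \<in> F" "\<And>f. f \<in> F \<Longrightarrow> g \<inter> f \<noteq> {} \<Longrightarrow> f = g" by metis
    obtain f where f: "f \<in> D" "f \<noteq> g" "g \<inter> f \<noteq> {}" using D_iso[of g] g(1) F_iff by metis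
    then have "f = {a, b}" using g(2)[of f] F_iff[of f] by blast
    then obtain s where s: "s \<in> {a, b}" "s \<in> g" using f(3) by blast
    obtain l where l: "g = {s, l}" "s \<noteq> l" 
      using edge_at[OF F_edge[OF g(1)] s(2)] by metis
    have "l \<notin> {a, b}" using l s(1) g(1) by (auto simp: F_iff insert_commute)
    have *: "k = s" if "{l, k} \<in> D" for k
    proof -
      have "{l, k} \<in> F" using that \<open>l \<notin> {a, b}\<close> by (auto simp: F_iff doubleton_eq_iff)
      then have "{l, k} = g" using l by (intro g(2)) auto
      then show ?thesis using l by (auto simp: doubleton_eq_iff)
    qed
    have sl: "{s, l} \<in> D" using g(1) l F_iff by simp
    then have "{l, s} \<in> D" by (simp add: insert_commute)
    then have "nbrs D l = {s}" using * by (rule nbrs_eqI)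
    then have "leaf l" unfolding leaf_def by blast
    moreover have "z \<in> {s, l}" if "reach F s z" for z
      using that
    proof (rule reach_closed)
      fix x y assume xy: "x \<in> {s, l}" "{x, y} \<in> F"
      then have "{x, y} = g" using l by (intro g(2)) auto
      then show "y \<in> {s, l}" using l by (auto simp: doubleton_eq_iff)
    qed simp
    ultimately have "{s, l} \<in> D \<and> leaf l \<and> (\<forall>z. reach F s z \<longrightarrow> z \<in> {s, l})"
      using sl by blast
    then show ?thesis using s(1) by blast
  next
    case True
    then have iso: "\<And>e. e \<in> F \<Longrightarrow> \<exists>f\<in>F. f \<noteq> e \<and> e \<inter> f \<noteq> {}" by blast
    obtain e f where e: "e \<in> E - F" and f: "f \<in> E - F" and dj: "e \<inter> f = {}"
      and same: "\<And>g. g \<in> F \<Longrightarrow> (g \<inter> e = {}) = (g \<inter> f = {})"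
    proof (rule ccontr)
      assume no: "\<not> thesis"
      have "valid E F"
      proof (rule valid)
        fix e f
        assume "e \<in> E - F" "f \<in> E - F" "e \<inter> f = {}"
          and "\<And>g. g \<in> F \<Longrightarrow> (g \<inter> e = {}) = (g \<inter> f = {})"
        then have thesis by (rule that)
        then show False using no by simp
      qed (rule iso)
      then show False using \<open>\<not> valid E F\<close> by simp
    qed
    have cross1: "y \<in> f" if "{x, y} \<in> F" "x \<in> e" for x y
      using same[OF that(1)] that(2) dj by auto
    have cross2: "y \<in> e" if "{x, y} \<in> F" "x \<in> f" for x y
      using same[OF that(1)] that(2) dj by auto
    have not_ab: False
      if e: "e = {a, b}" and f: "f \<in> E"
        and c1: "\<And>x y. {x, y} \<in> F \<Longrightarrow> x \<in> e \<Longrightarrow> y \<in> f"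
        and c2: "\<And>x y. {x, y} \<in> F \<Longrightarrow> x \<in> f \<Longrightarrow> y \<in> e" for e f
    proof -
      have af: "a' \<in> f" "b' \<in> f" using c1[OF aF] c1[OF bF] e by simp_all
      have r: "reach F a a'" "reach F b' b"
        using reach_edge[OF aF] reach_sym[OF reach_edge[OF bF]] by simp_all
      then have "a' \<noteq> b'" using bridge reach_trans by metis
      obtain k where "f = {a', k}" using edge_at[OF f af(1)] by metis
      then have fe: "f = {a', b'}" using af(2) \<open>a' \<noteq> b'\<close> by auto
      obtain g where g: "g \<in> F" "g \<noteq> {a, a'}" "{a, a'} \<inter> g \<noteq> {}" using iso[OF aF] by blast
      then consider "a \<in> g" | "a' \<in> g" by blast
      then show False
      proof cases
        case 1
        then obtain c where c: "g = {a, c}" using edge_at F_edge g(1) by metis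
        then have "c = b'" using c1[of a c] g e fe by auto
        then have "reach F a b'" using g(1) c by (intro reach_edge) simp
        then show False using r(2) bridge reach_trans by metis
      next
        case 2
        then obtain c where c: "g = {a', c}" using edge_at F_edge g(1) by metis
        then have "c = b" using c2[of a' c] g e af by (auto simp: insert_commute)
        then have "reach F a' b" using g(1) c by (intro reach_edge) simp
        then show False using r(1) bridge reach_trans by metis
      qed
    qed
    have "e \<noteq> {a, b}" using not_ab[of e f] f cross1 cross2 by blast
    then have eD: "e \<in> E - D" using e F_iff[of e] by simp
    have "f \<noteq> {a, b}" using not_ab[of f e] e cross1 cross2 by blast
    then have fD: "f \<in> E - D" using f F_iff[of f] by simp
    have "\<exists>s\<in>{a, b}. s \<in> e \<union> f"
    proof (rule ccontr)
      assume "\<not> ?thesis"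
      then have "(g \<inter> e = {}) = (g \<inter> f = {})" if "g \<in> D" for g
        using same[of g] that F_iff[of g] by (cases "g = {a, b}") auto
      then show False using D_sep[OF eD fD dj] by blast
    qed
    then obtain s where s: "s \<in> {a, b}" "s \<in> e \<union> f" by blast
    have "1 \<le> weight z" if r: "reach F s z" for z
    proof -
      have "z \<in> e \<union> f"
        using r s(2) by (rule reach_closed) (use cross1 cross2 in blast)
      then obtain h where h: "h \<in> E - D" "z \<in> h" using eD fD by blast
      then obtain y where y: "h = {z, y}" using edge_at by (metis DiffD1)
      have rD: "reach D s z" using r F_sub by (rule reach_mono)
      have "s \<in> \<Union>D" using s(1) ab(1) by blast
      then have "z \<in> \<Union>D" using rD reach_cov by blast
      moreover have "\<not> special z"
      proof
        assume sp: "special z"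
        have "reach D s a" "reach D s b"
          using s(1) reach_edge[OF ab(1)] reach_sym[OF reach_edge[OF ab(1)]] by auto
        then have "reach D z a" "reach D z b" using reach_trans[OF reach_sym[OF rD]] by blast+
        then have "a = z" "b = z" using special_reach[OF sp] ab(2,3) by blast+
        then show False using \<open>a \<noteq> b\<close> by simp
      qed
      ultimately show ?thesis using h(1) y by (intro weight_pos) auto
    qed
    then show ?thesis using s(1) by blast
  qed
  then show ?thesis by (simp only: F_def)
qed

lemma leaf_cases:
  assumes l: "leaf l" and pl: "{p, l} \<in> D"
    and not_P3: "\<And>q. q \<noteq> l \<Longrightarrow> nbrs D p = {l, q} \<Longrightarrow> leaf q \<Longrightarrow> False"
  shows "2 \<le> weight l \<or> rich p \<or> card (comp l) \<le> (\<Sum>z\<in>comp l. weight z) + 1"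
proof (rule ccontr)
  assume "\<not> ?thesis"
  then have wl: "weight l < 2" and rp: "\<not> rich p"
    and bad: "(\<Sum>z\<in>comp l. weight z) + 1 < card (comp l)" by auto
  define F where "F = D - {{p, l}}"
  have F_iff: "g \<in> F \<longleftrightarrow> g \<in> D \<and> g \<noteq> {p, l}" for g by (auto simp: F_def)
  have F_sub: "F \<subseteq> D" by (auto simp: F_def)
  have F_edge: "g \<in> E" if "g \<in> F" for g using that F_sub D_sub by blast
  have F_D: "{a, b} \<in> D" if "{a, b} \<in> F" for a b using that F_sub by blast
  have lp: "{l, p} \<in> D" using pl by (simp add: insert_commute)
  have nl: "k = p" if "{l, k} \<in> D" for k using leafD[OF l that lp] .
  have "p \<noteq> l" using pl D_neq by blast
  have lF: "{l, k} \<notin> F" "{k, l} \<notin> F" for k using nl[of k] by (auto simp: F_iff insert_commute)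
  have np: "\<not> leaf p" using D_parent_nonleaf[OF lp l] .
  obtain q where q: "{p, q} \<in> D" "q \<noteq> l" using not_leaf_ex[OF np pl] by blast
  have DF: "{a, b} \<in> F" if "{a, b} \<in> D" "a \<noteq> l" "b \<noteq> l" for a b
    using that by (auto simp: F_iff doubleton_eq_iff)
  have qF: "{p, q} \<in> F" using q \<open>p \<noteq> l\<close> by (intro DF) auto
  have covF: "\<Union>F = \<Union>D - {l}"
  proof
    show "\<Union>F \<subseteq> \<Union>D - {l}"
    proof
      fix z assume "z \<in> \<Union>F"
      then obtain g where g: "g \<in> F" "z \<in> g" by blast
      then obtain k where "g = {z, k}" using edge_at F_edge by metis
      then have "z \<noteq> l" using lF g(1) by auto
      then show "z \<in> \<Union>D - {l}" using g F_sub by blast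
    qed
    show "\<Union>D - {l} \<subseteq> \<Union>F"
    proof
      fix z assume z: "z \<in> \<Union>D - {l}"
      then obtain g where g: "g \<in> D" "z \<in> g" by blast
      show "z \<in> \<Union>F"
      proof (cases "g = {p, l}")
        case True
        then have "z = p" using z g by auto
        then show ?thesis using qF by blast
      next
        case False
        then have "g \<in> F" using g(1) F_iff by simp
        then show ?thesis using g(2) by blast
      qed
    qed
  qed
  have lcov: "l \<in> \<Union>D" "p \<in> \<Union>D" using pl by blast+
  have spl: "\<not> special l" using l special_not_leaf by blast
  have comp_nonspecial: "\<not> special z" if "z \<in> comp l" for z
  proof
    assume sp: "special z"
    have "reach D z l" using that by (simp add: comp_def reach_sym)
    moreover from this have "reach D z p" using lp by (rule reach_step)
    ultimately have "z = p"
      using special_reach[OF sp] np by blast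
    then have "nbrs D p = {l, the_elem (nbrs D p - {l})}" "leaf (the_elem (nbrs D p - {l}))"
      using special_reach[OF sp \<open>reach D z l\<close>] \<open>p \<noteq> l\<close> by auto
    moreover from this have "the_elem (nbrs D p - {l}) \<noteq> l" using np leaf_def by force
    ultimately show False using not_P3 by blast
  qed
  have iso: "\<exists>f\<in>F. f \<noteq> e \<and> e \<inter> f \<noteq> {}" if e: "e \<in> F" for e
  proof (rule ccontr)
    assume "\<not> ?thesis"
    then have no: "\<And>f. f \<in> F \<Longrightarrow> e \<inter> f \<noteq> {} \<Longrightarrow> f = e" by metis
    obtain f where f: "f \<in> D" "f \<noteq> e" "e \<inter> f \<noteq> {}" using D_iso[of e] e F_iff by metis
    then have "f = {p, l}" using no[of f] F_iff[of f] by blast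
    moreover have "l \<notin> e" using e covF by blast
    ultimately have "p \<in> e" using f(3) by auto
    then obtain k where k: "e = {p, k}" "p \<noteq> k" using edge_at[OF F_edge[OF e]] by metis
    have "k \<noteq> l" using k(1) e F_iff[of e] by auto
    have "{k, p} \<in> D" using e k(1) F_iff[of e] by (simp add: insert_commute)
    have "j = p" if "{k, j} \<in> D" for j
    proof -
      have "{k, j} \<in> F" using that k(2) \<open>k \<noteq> l\<close> by (auto simp: F_iff doubleton_eq_iff)
      then have "{k, j} = e" using k by (intro no) auto
      then show ?thesis using k by (auto simp: doubleton_eq_iff)
    qed
    with \<open>{k, p} \<in> D\<close> have "nbrs D k = {p}" by (rule nbrs_eqI)
    then have "leaf k" unfolding leaf_def by (rule exI)
    have "j \<in> {l, k}" if "{p, j} \<in> D" for j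
    proof (rule ccontr)
      assume "j \<notin> {l, k}"
      then have "{p, j} \<in> F" using that \<open>p \<noteq> l\<close> by (intro DF) auto
      then have "{p, j} = e" using k by (intro no) auto
      then show False using k \<open>j \<notin> {l, k}\<close> by (auto simp: doubleton_eq_iff)
    qed
    then have "nbrs D p \<subseteq> {l, k}" by (intro subsetI) simp
    moreover have "{l, k} \<subseteq> nbrs D p" using pl e k F_iff[of e] by simp
    ultimately have "nbrs D p = {l, k}" by (rule equalityI)
    then show False using not_P3[OF \<open>k \<noteq> l\<close> _ \<open>leaf k\<close>] by simp
  qed
  have dom: "e \<inter> \<Union>F \<noteq> {}" if e: "e \<in> E" for e
  proof
    assume no: "e \<inter> \<Union>F = {}"
    then have "l \<in> e" unfolding covF using D_dom[OF e] by blast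
    then obtain y where y: "e = {l, y}" "l \<noteq> y" using edge_at[OF e] by metis
    then have "y \<in> e" by simp
    then have "y \<notin> \<Union>D" using no y(2) unfolding covF by blast
    moreover have "{l, y} \<in> E" using y e by simp
    ultimately have "rich l" unfolding rich_def using lcov by blast
    then show False using weight_rich wl by (meson not_le)
  qed
  have unc: "a = b" if "{u, a} \<in> E" "{u, b} \<in> E" "a \<notin> \<Union>F" "b \<notin> \<Union>F" for u a b
  proof -
    have *: False if "{u, l} \<in> E" "{u, y} \<in> E" "y \<notin> \<Union>D" for y
    proof -
      have "u \<in> \<Union>D" using D_dom[OF that(2)] that(3) by auto
      then have "rich u" unfolding rich_def using that by blast
      then have "u \<noteq> p" using rp by blast
      then have "{l, u} \<in> E - D" using nl that(1) by (auto simp: insert_commute)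
      then have "2 \<le> weight l" using weight_giver lcov spl \<open>rich u\<close> by blast
      then show False using wl by simp
    qed
    show ?thesis using that *[of a] *[of b] D_unc[of u a b] unfolding covF by blast
  qed
  have sep: False if e: "e \<in> E - F" and f: "f \<in> E - F" and dj: "e \<inter> f = {}"
    and same: "\<And>g. g \<in> F \<Longrightarrow> (g \<inter> e = {}) = (g \<inter> f = {})" for e f
  proof -
    have cross1: "y \<in> f" if "{x, y} \<in> F" "x \<in> e" for x y
      using same[OF that(1)] that(2) dj by auto
    have cross2: "y \<in> e" if "{x, y} \<in> F" "x \<in> f" for x y
      using same[OF that(1)] that(2) dj by auto
    show False
    proof (cases "p \<in> e \<union> f")
      case True
      have comp_sub: "comp l \<subseteq> e \<union> f \<union> {l}"
      proof
        fix z assume "z \<in> comp l"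
        then have "reach D l z" by (simp add: comp_def)
        then show "z \<in> e \<union> f \<union> {l}"
        proof (rule reach_closed)
          fix x y assume xy: "x \<in> e \<union> f \<union> {l}" "{x, y} \<in> D"
          show "y \<in> e \<union> f \<union> {l}"
          proof (cases "x = l \<or> y = l")
            case True
            then show ?thesis using nl[of y] xy \<open>p \<in> e \<union> f\<close> by auto
          next
            case False
            then show ?thesis using DF[OF xy(2)] xy(1) cross1 cross2 by blast
          qed
        qed simp
      qed
      have star: False
        if e: "e = {p, l}" and f: "f \<in> E - F" and dj: "e \<inter> f = {}"
          and c1: "\<And>x y. {x, y} \<in> F \<Longrightarrow> x \<in> e \<Longrightarrow> y \<in> f"
          and c2: "\<And>x y. {x, y} \<in> F \<Longrightarrow> x \<in> f \<Longrightarrow> y \<in> e"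
          and sub: "comp l \<subseteq> e \<union> f \<union> {l}" for e f
      proof -
        have "q \<in> f" using c1[OF qF] e by simp
        obtain g where g: "g \<in> F" "g \<noteq> {p, q}" "{p, q} \<inter> g \<noteq> {}" using iso[OF qF] by blast
        have "p \<in> g"
        proof (rule ccontr)
          assume "p \<notin> g"
          then have "q \<in> g" using g(3) by blast
          then obtain k where k: "g = {q, k}" using edge_at F_edge g(1) by metis
          then have "k \<in> {p, l}" using c2[of q k] g(1) \<open>q \<in> f\<close> e by simp
          then show False using k \<open>p \<notin> g\<close> g(1) lF by auto
        qed
        then obtain r where r: "g = {p, r}" using edge_at F_edge g(1) by metis
        then have rF: "{p, r} \<in> F" "r \<noteq> q" using g by auto
        then have "r \<in> f" using c1[OF rF(1)] e by simp
        obtain k where "f = {q, k}" using edge_at[of f q] f \<open>q \<in> f\<close> by (metis DiffD1)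
        then have fe: "f = {q, r}" using \<open>r \<in> f\<close> \<open>r \<noteq> q\<close> by auto
        have ne: "q \<noteq> p" "q \<noteq> l" "r \<noteq> p" "r \<noteq> l" using dj e fe by auto
        have qr: "{q, r} \<in> E - D" using f fe ne by (auto simp: F_iff doubleton_eq_iff)
        then have rq: "{r, q} \<in> E - D" by (simp add: insert_commute)
        have leaves: "leaf q" "leaf r"
        proof -
          have *: "leaf k" if "k \<in> f" "{p, k} \<in> D" for k
          proof -
            have "{k, p} \<in> D" using that(2) by (simp add: insert_commute)
            moreover have "j = p" if kj: "{k, j} \<in> D" for j
            proof (rule ccontr)
              assume "j \<noteq> p"
              have "k \<noteq> l" using \<open>k \<in> f\<close> dj e by auto
              moreover have "k \<noteq> p" using \<open>k \<in> f\<close> dj e by auto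
              ultimately have "{k, j} \<in> F" using kj by (auto simp: F_iff doubleton_eq_iff)
              then have "j = l" using c2[OF \<open>{k, j} \<in> F\<close> \<open>k \<in> f\<close>] e \<open>j \<noteq> p\<close> by simp
              then show False using \<open>{k, j} \<in> F\<close> lF by blast
            qed
            ultimately have "nbrs D k = {p}" by (rule nbrs_eqI)
            then show ?thesis unfolding leaf_def by (rule exI)
          qed
          show "leaf q" using \<open>q \<in> f\<close> F_D[OF qF] by (rule *)
          show "leaf r" using \<open>r \<in> f\<close> F_D[OF rF(1)] by (rule *)
        qed
        have "card (comp l) \<le> card {p, l, q, r}"
          using sub unfolding e fe by (intro card_mono) auto
        also have "\<dots> \<le> 4" by (simp add: card_insert_if)
        finally have s2: "(\<Sum>z\<in>comp l. weight z) \<le> 2" using bad by linarith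
        have "reach D l p" using lp by (rule reach_edge)
        then have in_comp: "q \<in> comp l" "r \<in> comp l"
          using reach_step[OF _ F_D[OF qF]] reach_step[OF _ F_D[OF rF(1)]] by (simp_all add: comp_def)
        then have "weight q + weight r \<le> (\<Sum>z\<in>comp l. weight z)"
          using sum_mono2[of "comp l" "{q, r}" weight] fin_comp[OF lcov(1)] rF(2) by simp
        moreover have qrcov: "q \<in> \<Union>D" "r \<in> \<Union>D"
          using F_D[OF qF] F_D[OF rF(1)] by blast+
        moreover have sp: "\<not> special q" "\<not> special r" using comp_nonspecial in_comp by blast+
        moreover have "1 \<le> weight q" "1 \<le> weight r"
          using weight_pos qrcov sp qr rq by blast+
        ultimately have w: "weight q = 1" "weight r = 1" using s2 by linarith+
        have one: "nbrs (E - D) a \<subseteq> {b}"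
          if "a \<in> \<Union>D" "\<not> special a" "weight a = 1" "{a, b} \<in> E - D" for a b
        proof -
          have "card (nbrs (E - D) a) \<le> Suc 0" using weight_card[OF that(1,2)] that(3) by simp
          moreover have "finite (nbrs (E - D) a)" by (rule fin_nbrs) blast
          moreover have "b \<in> nbrs (E - D) a" using that(4) by simp
          ultimately have "\<forall>c\<in>nbrs (E - D) a. c = b" using card_le_Suc0_iff_eq by metis
          then show ?thesis by blast
        qed
        show False
        proof (rule leaf_twins[of p q r])
          show "{p, q} \<in> D" "{p, r} \<in> D" using F_D qF rF(1) by blast+
          show "q \<noteq> r" using rF(2) by simp
          show "nbrs (E - D) q \<subseteq> {r}" "nbrs (E - D) r \<subseteq> {q}"
            using one qrcov sp w qr rq by blast+
        qed (fact leaves)+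
      qed
      have "e \<noteq> {p, l}"
      proof
        assume "e = {p, l}"
        from star[OF this f dj cross1 cross2 comp_sub] show False .
      qed
      moreover have "f \<noteq> {p, l}"
      proof
        assume fpl: "f = {p, l}"
        have "f \<inter> e = {}" "comp l \<subseteq> f \<union> e \<union> {l}" using dj comp_sub by blast+
        from star[OF fpl e this(1) cross2 cross1 this(2)] show False .
      qed
      ultimately have eD: "e \<in> E - D" "f \<in> E - D"
        using e f F_iff[of e] F_iff[of f] by simp_all
      have "1 \<le> weight z" if z: "z \<in> comp l" "z \<noteq> l" for z
      proof -
        have "z \<in> e \<union> f" using z comp_sub by blast
        then obtain h where h: "h \<in> E - D" "z \<in> h" using eD by blast
        then obtain y where y: "h = {z, y}" using edge_at by (metis DiffD1)
        show ?thesis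
          using comp_nonspecial[OF z(1)] comp_cov[OF lcov(1)] z(1) h(1) y by (intro weight_pos) auto
      qed
      then have "card (comp l) \<le> (\<Sum>z\<in>comp l. weight z) + 1"
        using fin_comp[OF lcov(1)] by (intro comp_bound[of _ l]) (auto simp: comp_def)
      then show False using bad by simp
    next
      case False
      then have eD: "e \<in> E - D" "f \<in> E - D"
        using e f F_iff[of e] F_iff[of f] by auto
      have l_notin: False
        if e: "e \<in> E - D" and f: "f \<in> E - D" and dj: "e \<inter> f = {}" and "p \<notin> e \<union> f" "l \<in> f"
          and c1: "\<And>x y. {x, y} \<in> F \<Longrightarrow> x \<in> e \<Longrightarrow> y \<in> f"
          and c2: "\<And>x y. {x, y} \<in> F \<Longrightarrow> x \<in> f \<Longrightarrow> y \<in> e" for e f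
      proof -
        obtain x where x: "f = {l, x}" "l \<noteq> x" using edge_at[of f l] f \<open>l \<in> f\<close> by (metis DiffD1)
        have "e \<inter> \<Union>F \<noteq> {}" using dom[of e] e by simp
        then obtain u h where u: "u \<in> e" "h \<in> F" "u \<in> h" by blast
        then obtain w where "h = {u, w}" using edge_at F_edge by metis
        then have uw: "{u, w} \<in> F" using u by simp
        then have "w = x" using c1[OF uw u(1)] x lF by auto
        then have ux: "{u, x} \<in> F" using uw by simp
        then have xu: "{x, u} \<in> F" by (simp add: insert_commute)
        have c1x: "k = x" if "a \<in> e" "{a, k} \<in> F" for a k
          using c1[OF that(2,1)] that(2) x lF by auto
        obtain g where g: "g \<in> F" "g \<noteq> {u, x}" "{u, x} \<inter> g \<noteq> {}" using iso[OF ux] by blast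
        have "x \<in> g"
        proof (rule ccontr)
          assume "x \<notin> g"
          then have "u \<in> g" using g(3) by blast
          then obtain k where k: "g = {u, k}" using edge_at F_edge g(1) by metis
          then show False using c1x[OF u(1), of k] g by simp
        qed
        then obtain v where v: "g = {x, v}" using edge_at F_edge g(1) by metis
        then have "v \<noteq> u" using g(2) by (auto simp: insert_commute)
        have xv: "{x, v} \<in> F" using g(1) v by simp
        then have vx: "{v, x} \<in> F" by (simp add: insert_commute)
        have "v \<in> e" using c2[OF xv] x by simp
        obtain k where "e = {u, k}" using edge_at[of e u] e u(1) by (metis DiffD1)
        then have "e = {u, v}" using \<open>v \<in> e\<close> \<open>v \<noteq> u\<close> by auto
        have "x \<noteq> p" "x \<noteq> l" using x \<open>p \<notin> e \<union> f\<close> by auto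
        have e_ne: "a \<noteq> p" "a \<noteq> l" if "a \<in> e" for a
          using that \<open>p \<notin> e \<union> f\<close> dj \<open>l \<in> f\<close> by blast+
        have toF: "{a, k} \<in> F" if "{a, k} \<in> D" "a \<noteq> p" "a \<noteq> l" for a k
          using that by (auto simp: F_iff doubleton_eq_iff)
        have nbrs_x: "nbrs D x = {u, v}"
        proof
          show "nbrs D x \<subseteq> {u, v}"
          proof
            fix k assume "k \<in> nbrs D x"
            then have "{x, k} \<in> F" using toF \<open>x \<noteq> p\<close> \<open>x \<noteq> l\<close> by simp
            then have "k \<in> e" using c2[of x k] x(1) by simp
            then show "k \<in> {u, v}" using \<open>e = {u, v}\<close> by simp
          qed
          show "{u, v} \<subseteq> nbrs D x" using F_D[OF xu] F_D[OF xv] by simp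
        qed
        have nbx: "nbrs D a = {x}" if "a \<in> e" "{a, x} \<in> F" for a
        proof (rule nbrs_eqI)
          show "{a, x} \<in> D" using that(2) by (rule F_D)
          show "k = x" if "{a, k} \<in> D" for k
            using c1x[OF \<open>a \<in> e\<close> toF[OF that e_ne[OF \<open>a \<in> e\<close>]]] .
        qed
        have "{u, v} \<in> E" using e \<open>e = {u, v}\<close> by simp
        then have "special x"
          unfolding special_def using nbrs_x \<open>v \<noteq> u\<close> nbx[OF u(1) ux] nbx[OF \<open>v \<in> e\<close> vx]
          by (intro exI[of _ u] exI[of _ v] conjI) simp_all
        moreover have "{l, x} \<in> E - D" using f x by simp
        ultimately have "2 \<le> weight l" using weight_giver lcov spl by blast
        then show False using wl by simp
      qed
      have lf: "l \<notin> f"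
      proof
        assume lf: "l \<in> f"
        from l_notin[OF eD dj False lf cross1 cross2] show False .
      qed
      have le: "l \<notin> e"
      proof
        assume le: "l \<in> e"
        have "f \<inter> e = {}" "p \<notin> f \<union> e" using dj False by auto
        from l_notin[OF eD(2,1) this le cross2 cross1] show False .
      qed
      have "(g \<inter> e = {}) = (g \<inter> f = {})" if "g \<in> D" for g
      proof (cases "g = {p, l}")
        case True
        then show ?thesis using False lf le by simp
      next
        case False
        then show ?thesis using that same[of g] F_iff[of g] by simp
      qed
      then show False using D_sep[OF eD dj] by blast
    qed
  qed
  have "valid E F"
  proof (rule validI)
    show "F \<subseteq> E" using F_edge by blast
    show "acyc F" using D_acyc F_sub by (rule acyc_mono)
  qed (fact iso dom unc sep)+
  then have "card D \<le> card F" by (rule min_card)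
  then show False using card_Diff1_less[OF fin_D pl] by (simp add: F_def)
qed

text \<open>A path with two edges cannot lose a leaf. Instead, if its weight were too small, it would hang
  off some covered \<open>z\<close> by a single edge, and \<open>swap_contradiction\<close> would merge it with the
  component of \<open>z\<close>.\<close>

lemma P3_weight:
  assumes x: "nbrs D x = {u, v}" and "u \<noteq> v" and lu: "leaf u" and lv: "leaf v"
  shows "2 \<le> weight x + weight u + weight v"
proof -
  have xu: "{x, u} \<in> D" "{x, v} \<in> D" using x nbrs_iff[of _ D x] by auto
  then have ux: "{u, x} \<in> D" "{v, x} \<in> D" by (simp_all add: insert_commute)
  have nb: "nbrs D u = {x}" "nbrs D v = {x}" using leaf_nbrs[OF lu ux(1)] leaf_nbrs[OF lv ux(2)] .
  have cov: "x \<in> \<Union>D" "u \<in> \<Union>D" "v \<in> \<Union>D" using xu by blast+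
  have nsp: "\<not> special u" "\<not> special v" using special_not_leaf lu lv by blast+
  show ?thesis
  proof (cases "{u, v} \<in> E")
    case True
    have "{u, v} \<notin> D" using nb(1) nbrs_iff[of v D u] D_neq[OF ux(2)] by auto
    then have "{u, v} \<in> E - D" "{v, u} \<in> E - D" using True by (auto simp: insert_commute)
    then have "1 \<le> weight u" "1 \<le> weight v" using weight_pos cov nsp by blast+
    then show ?thesis by simp
  next
    case False
    have nspx: "\<not> special x"
    proof
      assume "special x"
      then obtain a b where "nbrs D x = {a, b}" "{a, b} \<in> E" unfolding special_def by blast
      then show False using x False by simp
    qed
    have *: False
      if x: "nbrs D x = {u, v}" and "u \<noteq> v" and lu: "leaf u" and lv: "leaf v"
        and w: "weight x + weight u + weight v \<le> 1" and wv: "weight v = 0"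
        and uv: "{u, v} \<notin> E" for u v
    proof -
      have xu: "{x, u} \<in> D" "{x, v} \<in> D" using x nbrs_iff[of _ D x] by auto
      then have ux: "{u, x} \<in> D" "{v, x} \<in> D" by (simp_all add: insert_commute)
      have nb: "nbrs D u = {x}" "nbrs D v = {x}" using leaf_nbrs[OF lu ux(1)] leaf_nbrs[OF lv ux(2)] .
      have cov: "x \<in> \<Union>D" "u \<in> \<Union>D" "v \<in> \<Union>D" using xu by blast+
      have nsp: "\<not> special u" "\<not> special v" using special_not_leaf lu lv by blast+
      have Rv: "nbrs (E - D) v = {}" using weight_0 cov nsp wv by blast
      have E_nbrs: "nbrs E a = nbrs D a" if "nbrs (E - D) a = {}" for a
        using that D_sub by (auto simp: nbrs_def)
      show False
      proof (cases "weight u = 0")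
        case True
        then have "nbrs (E - D) u = {}" using weight_0 cov nsp by blast
        then show False using leaf_twins[OF xu \<open>u \<noteq> v\<close> lu lv] Rv by blast
      next
        case False
        then have wx: "weight x = 0" "weight u = 1" using w by linarith+
        have Rx: "nbrs (E - D) x = {}" using weight_0[OF cov(1) nspx wx(1)] .
        have "nbrs (E - D) u \<noteq> {}"
          using wx(2) unfolding weight_def by auto
        then obtain z where z: "{u, z} \<in> E - D" by (auto simp: nbrs_def)
        have "z \<in> \<Union>D"
        proof (rule ccontr)
          assume "z \<notin> \<Union>D"
          then have "rich u" unfolding rich_def using z cov(2) by blast
          then show False using weight_rich wx(2) by fastforce
        qed
        then show False
          using swap_contradiction[of x u v z] E_nbrs[OF Rx] E_nbrs[OF Rv] x nb xu \<open>u \<noteq> v\<close> z by simp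
      qed
    qed
    show ?thesis
    proof (rule ccontr)
      assume "\<not> ?thesis"
      then have w: "weight x + weight u + weight v \<le> 1" by simp
      then consider "weight v = 0" | "weight u = 0" by linarith
      then show False
      proof cases
        case 1
        then show False using *[of u v] assms w False by blast
      next
        case 2
        have "nbrs D x = {v, u}" "{v, u} \<notin> E" using x False by (auto simp: insert_commute)
        then show False using *[of v u] assms w 2 by (simp add: add.commute add.left_commute)
      qed
    qed
  qed
qed

lemma comp_weight:
  assumes v: "v \<in> \<Union>D"
  shows "card (comp v) \<le> (\<Sum>z\<in>comp v. weight z) + 1"
proof (cases "\<exists>x\<in>comp v. \<exists>a b. a \<noteq> b \<and> nbrs D x = {a, b} \<and> leaf a \<and> leaf b")
  case True
  then obtain x a b where x: "x \<in> comp v" "a \<noteq> b" "nbrs D x = {a, b}" "leaf a" "leaf b" by blast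
  have xa: "{x, a} \<in> D" "{x, b} \<in> D" using x(3) nbrs_iff[of _ D x] by auto
  then have ax: "{a, x} \<in> D" "{b, x} \<in> D" by (simp_all add: insert_commute)
  have nb: "nbrs D a = {x}" "nbrs D b = {x}" using leaf_nbrs[OF x(4) ax(1)] leaf_nbrs[OF x(5) ax(2)] .
  have "comp v = comp x" using comp_eq x(1) by simp
  also have "\<dots> = {x, a, b}"
  proof
    have closed: "s \<in> {x, a, b}" if "r \<in> {x, a, b}" "{r, s} \<in> D" for r s
      using that x(3) nb nbrs_iff[of s D r] by auto
    show "comp x \<subseteq> {x, a, b}"
    proof
      fix z assume "z \<in> comp x"
      then have "reach D x z" by (simp add: comp_def)
      then show "z \<in> {x, a, b}" by (rule reach_closed) (use closed in auto)
    qed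
    show "{x, a, b} \<subseteq> comp x" using xa reach_edge by (auto simp: comp_def)
  qed
  finally have C: "comp v = {x, a, b}" .
  have "x \<noteq> a" "x \<noteq> b" using xa D_neq by blast+
  then show ?thesis using P3_weight[OF x(3,2,4,5)] x(2) unfolding C by simp
next
  case False
  show ?thesis
  proof (rule ccontr)
    assume bad: "\<not> ?thesis"
    let ?C = "comp v"
    have fin: "finite ?C" using v by (rule fin_comp)
    have Ccov: "?C \<subseteq> \<Union>D" using v by (rule comp_cov)
    have C_step: "b \<in> ?C" if "a \<in> ?C" "{a, b} \<in> D" for a b
      using reach_step[OF _ that(2)] that(1) by (simp add: comp_def)
    have leaf_bound: "2 \<le> weight l \<or> rich p" if l: "l \<in> ?C" "leaf l" "{p, l} \<in> D" for l p
    proof -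
      have "{l, p} \<in> D" using l(3) by (simp add: insert_commute)
      then have "p \<in> ?C" using C_step l(1) by blast
      then have "False" if "q \<noteq> l" "nbrs D p = {l, q}" "leaf q" for q
        using False that l(2) by metis
      from leaf_cases[OF l(2,3) this] show ?thesis using bad comp_eq[OF l(1)] by auto
    qed
    (* Vertices of weight 0 inject into those of weight at least 2, a leaf going to its neighbour and
       any other to a leaf next to it; only a nonleaf without leaf neighbours has no image, and
       internal_edge, applied on a path between two of those, shows that there is at most one. *)
    define Z where "Z = {z \<in> ?C. weight z = 0}"
    define T where "T = {z \<in> ?C. 2 \<le> weight z}"
    define S where "S = {z \<in> Z. leaf z \<or> (\<exists>l. {z, l} \<in> D \<and> leaf l)}"
    have finS: "finite Z" "finite T" "finite S" using fin unfolding Z_def T_def S_def by auto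
    have "\<exists>u. {z, u} \<in> D \<and> u \<in> T \<and> leaf u \<noteq> leaf z" if "z \<in> S" for z
    proof (cases "leaf z")
      case True
      then obtain p where "nbrs D z = {p}" unfolding leaf_def by blast
      then have zp: "{z, p} \<in> D" using nbrs_iff[of p D z] by simp
      then have "{p, z} \<in> D" by (simp add: insert_commute)
      moreover have "z \<in> ?C" "weight z = 0" using that by (auto simp: S_def Z_def)
      ultimately have "rich p" using leaf_bound[of z p] True by simp
      then have "p \<in> T" using weight_rich C_step \<open>z \<in> ?C\<close> zp unfolding T_def by blast
      then show ?thesis using zp True D_parent_nonleaf by blast
    next
      case False
      then obtain l where zl: "{z, l} \<in> D" "leaf l" using \<open>z \<in> S\<close> S_def by blast
      have z: "z \<in> ?C" "weight z = 0" using that by (auto simp: S_def Z_def)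
      then have "l \<in> ?C" using C_step zl by blast
      moreover have "\<not> rich z" using weight_rich z(2) by fastforce
      ultimately have "2 \<le> weight l" using leaf_bound zl by blast
      then show ?thesis using zl \<open>l \<in> ?C\<close> False unfolding T_def by blast
    qed
    then obtain h where h: "\<And>z. z \<in> S \<Longrightarrow> {z, h z} \<in> D \<and> h z \<in> T \<and> leaf (h z) \<noteq> leaf z"
      by metis
    have "inj_on h S"
    proof
      fix a b assume ab: "a \<in> S" "b \<in> S" "h a = h b"
      show "a = b"
      proof (rule ccontr)
        assume "a \<noteq> b"
        have hD: "{h a, a} \<in> D" "{h a, b} \<in> D"
          using h[OF ab(1)] h[OF ab(2)] ab(3) by (simp_all add: insert_commute)
        then have "\<not> leaf (h a)" using leafD \<open>a \<noteq> b\<close> by blast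
        then have lv: "leaf a" "leaf b" using h[OF ab(1)] h[OF ab(2)] ab(3) by auto
        moreover have "nbrs (E - D) z = {}" if "z \<in> S" "leaf z" for z
        proof (rule weight_0)
          show "z \<in> \<Union>D" using that(1) Ccov by (auto simp: S_def Z_def)
          show "\<not> special z" using that(2) special_not_leaf by blast
          show "weight z = 0" using that(1) by (simp add: S_def Z_def)
        qed
        ultimately show False
          using leaf_twins[OF hD \<open>a \<noteq> b\<close>] ab(1,2) by simp
      qed
    qed
    then have "card S \<le> card T" using h finS by (intro card_inj_on_le[of h]) auto
    have "a = b" if a: "a \<in> Z - S" and b: "b \<in> Z - S" for a b
    proof (rule ccontr)
      assume "a \<noteq> b"
      have nl: "\<not> leaf z \<and> (\<forall>l. {z, l} \<in> D \<longrightarrow> \<not> leaf l) \<and> weight z = 0" if "z \<in> Z - S" for z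
        using that by (auto simp: S_def Z_def)
      have "reach D v a" "reach D v b" using a b by (simp_all add: Z_def comp_def)
      then have "reach D a b" using reach_trans[OF reach_sym] by metis
      then obtain c where c: "{a, c} \<in> D" "reach (D - {{a, c}}) c b"
        using reach_first_edge[of D a b] \<open>a \<noteq> b\<close> by auto
      then obtain s where s: "s \<in> {a, c}"
        "(\<exists>l. {s, l} \<in> D \<and> leaf l \<and> (\<forall>z. reach (D - {{a, c}}) s z \<longrightarrow> z \<in> {s, l})) \<or>
         (\<forall>z. reach (D - {{a, c}}) s z \<longrightarrow> 1 \<le> weight z)"
        using internal_edge[OF c(1)] nl[OF a] c(1) by blast
      show False
      proof (cases "s = a")
        case True
        have "reach (D - {{a, c}}) s a" using True by simp
        then show False using s(2) nl[OF a] True by (metis not_one_le_zero)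
      next
        case False
        then have "s = c" using s(1) by simp
        from s(2) show False
        proof
          assume "\<exists>l. {s, l} \<in> D \<and> leaf l \<and> (\<forall>z. reach (D - {{a, c}}) s z \<longrightarrow> z \<in> {s, l})"
          then obtain l where l: "{s, l} \<in> D" "leaf l" "b \<in> {s, l}" using c(2) \<open>s = c\<close> by blast
          then show False using nl[OF b] by auto
        next
          assume "\<forall>z. reach (D - {{a, c}}) s z \<longrightarrow> 1 \<le> weight z"
          then have "1 \<le> weight b" using c(2) \<open>s = c\<close> by blast
          then show False using nl[OF b] by simp
        qed
      qed
    qed
    then have "card (Z - S) \<le> Suc 0" using finS card_le_Suc0_iff_eq[of "Z - S"] by blast
    moreover have "card Z = card S + card (Z - S)"
      using finS card_Un_disjoint[of S "Z - S"] by (simp add: S_def Un_absorb1)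
    ultimately have ZT: "card Z \<le> card T + 1" using \<open>card S \<le> card T\<close> by linarith
    have "card ?C + card T = (\<Sum>z\<in>?C. 1 + (if 2 \<le> weight z then 1 else 0))"
      unfolding T_def using fin by (simp only: card_eq_sum sum.distrib sum.inter_filter)
    also have "\<dots> \<le> (\<Sum>z\<in>?C. weight z + (if weight z = 0 then 1 else 0))"
      by (intro sum_mono) auto
    also have "\<dots> = (\<Sum>z\<in>?C. weight z) + card Z"
      unfolding Z_def using fin by (simp only: card_eq_sum sum.distrib sum.inter_filter)
    finally show False using ZT bad by linarith
  qed
qed

lemma card_D: "3 * card D \<le> 2 * card E"
proof -
  define rep where "rep v = (SOME u. reach D v u)" for v
  have rep: "reach D v (rep v)" for v
    unfolding rep_def by (rule someI[of _ v]) simp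
  have rep_eq: "rep u = rep v" if "reach D u v" for u v
  proof -
    have "reach D u = reach D v"
      using that by (intro ext) (meson reach_sym reach_trans)
    then show ?thesis unfolding rep_def by simp
  qed
  let ?S = "rep ` \<Union>D"
  have "card D + card ?S \<le> card (\<Union>D)"
  proof (rule acyc_card)
    show "e \<subseteq> \<Union>D \<and> card e = 2" if "e \<in> D" for e using that D_sub card2 by blast
    show "?S \<subseteq> \<Union>D" using reach_cov[OF rep] by blast
    show "s = t" if st: "s \<in> ?S" "t \<in> ?S" "reach D s t" for s t
    proof -
      obtain a b where "s = rep a" "t = rep b" using st by blast
      moreover from this have "reach D a b" using st(3) rep reach_sym reach_trans by metis
      ultimately show ?thesis using rep_eq by simp
    qed
  qed (fact fin_D fin_cov D_acyc)+
  moreover have "card (\<Union>D) \<le> (\<Sum>z\<in>\<Union>D. weight z) + card ?S"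
  proof -
    have fiber: "{v \<in> \<Union>D. rep v = rep a} = comp a" if "a \<in> \<Union>D" for a
    proof
      show "{v \<in> \<Union>D. rep v = rep a} \<subseteq> comp a"
      proof
        fix v assume "v \<in> {v \<in> \<Union>D. rep v = rep a}"
        then have "reach D v (rep a)" using rep[of v] by simp
        then have "reach D a v" using reach_trans[OF rep[of a] reach_sym] by blast
        then show "v \<in> comp a" by (simp add: comp_def)
      qed
      show "comp a \<subseteq> {v \<in> \<Union>D. rep v = rep a}"
        using comp_cov[OF that] rep_eq unfolding comp_def by auto
    qed
    have "card (\<Union>D) = (\<Sum>s\<in>?S. card {v \<in> \<Union>D. rep v = s})"
      using fin_cov sum.group[of "\<Union>D" ?S rep "\<lambda>_. 1::nat"] by simp
    also have "\<dots> \<le> (\<Sum>s\<in>?S. (\<Sum>z\<in>{v \<in> \<Union>D. rep v = s}. weight z) + 1)"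
    proof (rule sum_mono)
      fix s assume "s \<in> ?S"
      then obtain a where "a \<in> \<Union>D" "s = rep a" by blast
      then show "card {v \<in> \<Union>D. rep v = s} \<le> (\<Sum>z\<in>{v \<in> \<Union>D. rep v = s}. weight z) + 1"
        using comp_weight[of a] fiber[of a] by simp
    qed
    also have "\<dots> = (\<Sum>s\<in>?S. \<Sum>z\<in>{v \<in> \<Union>D. rep v = s}. weight z) + card ?S"
      by (simp only: sum.distrib card_eq_sum)
    also have "(\<Sum>s\<in>?S. \<Sum>z\<in>{v \<in> \<Union>D. rep v = s}. weight z) = (\<Sum>z\<in>\<Union>D. weight z)"
      using fin_cov by (intro sum.group) auto
    finally show ?thesis .
  qed
  moreover have "card (E - D) = card E - card D" "card D \<le> card E"
    using D_sub fin fin_D by (auto intro: card_Diff_subset card_mono)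
  ultimately show ?thesis using sum_weight by linarith
qed

end

theorem theorem4:
  fixes V :: "'a set" and E :: "'a set set"
  assumes "finite_simple_graph V E"
    and "edge_twin_free E"
    and "\<nexists>e. isolated_edge E e"
  shows "real (edge_location_total_domination_number E) \<le> 2 / 3 * real (card E)"
proof -
  interpret twin_free_graph E
  proof
    have "E \<subseteq> Pow V" "finite V" using assms(1) unfolding finite_simple_graph_def by blast+
    then show "finite E" by (meson finite_Pow_iff finite_subset)
    show "card e = 2" if "e \<in> E" for e
      using assms(1) that unfolding finite_simple_graph_def by blast
  qed (fact assms)+
  obtain F where "valid E F" using valid_exists by blast
  from ex_has_least_nat[of "valid E", OF this, of card]
  obtain F' where F': "valid E F'" "\<And>F. valid E F \<Longrightarrow> card F' \<le> card F" by blast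
  define P where "P F \<longleftrightarrow> valid E F \<and> card F = card F'" for F
  have "P F'" using F'(1) by (simp add: P_def)
  from ex_has_least_nat[of P, OF this, of "\<lambda>F. card (\<Union>F)"]
  obtain D where "P D" and D: "\<And>F. P F \<Longrightarrow> card (\<Union>D) \<le> card (\<Union>F)" by blast
  then have vD: "valid E D" and cD: "card D = card F'" by (simp_all add: P_def)
  interpret minimal_valid E D
  proof
    show "valid E D" by (rule vD)
    show "card D \<le> card F" if "valid E F" for F using F'(2)[OF that] cD by simp
    show "card (\<Union>D) \<le> card (\<Union>F)" if "valid E F" "card F = card D" for F
      using that cD by (intro D) (simp add: P_def)
  qed
  have "edge_location_total_domination_number E \<le> card D"
    unfolding edge_location_total_domination_number_def
    using valid_imp_elt[OF vD] by (intro Least_le) blast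
  then have "3 * edge_location_total_domination_number E \<le> 2 * card E"
    using card_D by linarith
  then show ?thesis by linarith
qed

end
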